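(* Let $\Bbbk$ be a field of characteristic not $2$, let $\delta\in\Bbbk$ with $\delta\neq-2$, and let $\alpha\in\Bbbk^\times$. If $\mathcal I$ is a tensor ideal of $\mathcal T_{\delta,\alpha}$ such that $$\dim_{\Bbbk}\left((\mathcal T_{\delta,\alpha}/\mathcal I)(X^{\otimes 2},X^{\otimes 2})\right)=3,$$ then the relations $$D=K-H,\qquad K=\frac{\alpha}{2}\left(1_{X\otimes X}-s\right)$$ hold in the quotient category $\mathcal T_{\delta,\alpha}/\mathcal I$. In particular, $X$ (with bracket $m$) is a Lie algebra object of dimension $3$ in $\mathcal T_{\delta,\alpha}/\mathcal I$ (so that $\delta=3$ in $\Bbbk$).
   Context: All categories are $\Bbbk$-linear; $\mathcal C(Y,Z)$ denotes the space of morphisms $Y\to Z$ in $\mathcal C$. $\mathcal T_{\delta,\alpha}$ is the strict $\Bbbk$-linear monoidal category (unit object $\mathbf 1$) generated by one object $X$ and morphisms $$m\colon X\otimes X\to X,\quad s\colon X\otimes X\to X\otimes X,\quad \eta\colon\mathbf 1\to X\otimes X,\quad \varepsilon\colon X\otimes X\to\mathbf 1,$$ subject to the following relations (writing $1$ for $\mathrm{id}_X$ and composing right to left): (i) $(\varepsilon\otimes1)(1\otimes\eta)=1=(1\otimes\varepsilon)(\eta\otimes1)$; (ii) $\sigma:=(1\otimes m)(\eta\otimes 1)=(m\otimes1)(1\otimes\eta)\colon X\to X\otimes X$; (iii) $(1\otimes\varepsilon)(s\otimes1)=(\varepsilon\otimes1)(1\otimes s)$; (iv) $s\circ s=1\otimes1$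 and $(s\otimes1)(1\otimes s)(s\otimes1)=(1\otimes s)(s\otimes1)(1\otimes s)$; (v) $(1\otimes m)(s\otimes1)(1\otimes s)=s(m\otimes1)$ and $(1\otimes s)(s\otimes1)(1\otimes\sigma)=(\sigma\otimes1)s$; (vi) $\varepsilon s=\varepsilon$, $\; m s=-m$, $\; m\sigma=\alpha\,1$, $\;\varepsilon\eta=\delta\,\mathrm{id}_{\mathbf 1}$. It is symmetric monoidal with braiding determined by $s$. Notation for endomorphisms of $X\otimes X$: $$K:=\sigma m,\qquad H:=(m\otimes1)(1\otimes\sigma)=(1\otimes m)(\sigma\otimes1),\qquad D:=(m\otimes1)(1\otimes s)(\sigma\otimes1).$$ A tensor ideal $\mathcal I$ of a $\Bbbk$-linear monoidal category $\mathcal C$ is a collection of subspaces $\mathcal I(Y,Z)\subseteq\mathcal C(Y,Z)$, for all objects $Y,Z$, closed under composition on either side with arbitrary morphisms of $\mathcal C$ and under tensoring on either side with identity morphisms. The quotient $\mathcal C/\mathcal I$ has the same objects as $\mathcal C$ and morphism spaces $\mathcal C(Y,Z)/\mathcal I(Y,Z)$. A Lie algebra object in a symmetric $\Bbbk$-linear monoidal category with braiding $s$ is an object $L$ with a morphism $\beta\colon L\otimes L\to L$ such that $\beta s=-\beta$ and $\beta(\beta\otimes1)(1\otimes s)=\beta(\beta\otimes1)-\beta(1\otimes\beta)$. The dimension of the self-dual object $X$ is its trace $\mathrm{tr}(1_X)=\varepsilon\eta=\delta\,\mathrm{id}_{\mathbf 1}$, identified with the scalar $\delta$. *)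

theory Defs
  imports "HOL-Algebra.AbelCoset" "Jordan_Normal_Form.VS_Connect"
begin

text \<open>
  The objects are all elements of the type \<open>'o\<close>; every hom space is a HOL-Algebra module record whose
  scalars are the field type \<open>'k\<close> (as the ring \<open>class_ring\<close>). The \<open>mult\<close> and \<open>one\<close> fields of these
  records are irrelevant. Hom sets need not be disjoint, so composition and tensor product
  of morphisms take the objects as arguments:
  for \<open>f : X \<rightarrow> Y\<close> and \<open>g : Y \<rightarrow> Z\<close> the composite \<open>g \<circ> f\<close> is \<open>Cmp C X Y Z g f\<close>, and
  for \<open>f : X \<rightarrow> Y\<close> and \<open>f' : X' \<rightarrow> Y'\<close> the morphism \<open>f \<otimes> f'\<close> is \<open>Tns C X Y X' Y' f f'\<close>.
\<close>

record ('o, 'm, 'k) lin_moncat =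
  Hom :: "'o \<Rightarrow> 'o \<Rightarrow> ('k, 'm) module"
  Idn :: "'o \<Rightarrow> 'm"
  Cmp :: "'o \<Rightarrow> 'o \<Rightarrow> 'o \<Rightarrow> 'm \<Rightarrow> 'm \<Rightarrow> 'm"
  Unt :: "'o"
  Otm :: "'o \<Rightarrow> 'o \<Rightarrow> 'o"
  Tns :: "'o \<Rightarrow> 'o \<Rightarrow> 'o \<Rightarrow> 'o \<Rightarrow> 'm \<Rightarrow> 'm \<Rightarrow> 'm"

abbreviation Mor :: "('o, 'm, 'k) lin_moncat \<Rightarrow> 'o \<Rightarrow> 'o \<Rightarrow> 'm set" where
  "Mor C X Y \<equiv> carrier (Hom C X Y)"

locale strict_lin_moncat =
  fixes C :: "('o, 'm, 'k::field) lin_moncat"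
  assumes hom_vs: "vectorspace class_ring (Hom C X Y)"
    and idn_closed: "Idn C X \<in> Mor C X X"
    and cmp_closed: "\<lbrakk>f \<in> Mor C X Y; g \<in> Mor C Y Z\<rbrakk> \<Longrightarrow> Cmp C X Y Z g f \<in> Mor C X Z"
    and cmp_idn_left: "f \<in> Mor C X Y \<Longrightarrow> Cmp C X Y Y (Idn C Y) f = f"
    and cmp_idn_right: "f \<in> Mor C X Y \<Longrightarrow> Cmp C X X Y f (Idn C X) = f"
    and cmp_assoc: "\<lbrakk>f \<in> Mor C W X; g \<in> Mor C X Y; h \<in> Mor C Y Z\<rbrakk> \<Longrightarrow>
      Cmp C W X Z (Cmp C X Y Z h g) f = Cmp C W Y Z h (Cmp C W X Y g f)"
    and cmp_add_left: "\<lbrakk>f \<in> Mor C X Y; g \<in> Mor C Y Z; g' \<in> Mor C Y Z\<rbrakk> \<Longrightarrow>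
      Cmp C X Y Z (g \<oplus>\<^bsub>Hom C Y Z\<^esub> g') f = Cmp C X Y Z g f \<oplus>\<^bsub>Hom C X Z\<^esub> Cmp C X Y Z g' f"
    and cmp_add_right: "\<lbrakk>f \<in> Mor C X Y; f' \<in> Mor C X Y; g \<in> Mor C Y Z\<rbrakk> \<Longrightarrow>
      Cmp C X Y Z g (f \<oplus>\<^bsub>Hom C X Y\<^esub> f') = Cmp C X Y Z g f \<oplus>\<^bsub>Hom C X Z\<^esub> Cmp C X Y Z g f'"
    and cmp_smult_left: "\<lbrakk>f \<in> Mor C X Y; g \<in> Mor C Y Z\<rbrakk> \<Longrightarrow>
      Cmp C X Y Z (c \<odot>\<^bsub>Hom C Y Z\<^esub> g) f = c \<odot>\<^bsub>Hom C X Z\<^esub> Cmp C X Y Z g f"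
    and cmp_smult_right: "\<lbrakk>f \<in> Mor C X Y; g \<in> Mor C Y Z\<rbrakk> \<Longrightarrow>
      Cmp C X Y Z g (c \<odot>\<^bsub>Hom C X Y\<^esub> f) = c \<odot>\<^bsub>Hom C X Z\<^esub> Cmp C X Y Z g f"
    and otm_assoc: "Otm C (Otm C X Y) Z = Otm C X (Otm C Y Z)"
    and otm_unt_left: "Otm C (Unt C) X = X"
    and otm_unt_right: "Otm C X (Unt C) = X"
    and tns_closed: "\<lbrakk>f \<in> Mor C X Y; f' \<in> Mor C X' Y'\<rbrakk> \<Longrightarrow>
      Tns C X Y X' Y' f f' \<in> Mor C (Otm C X X') (Otm C Y Y')"
    and tns_assoc: "\<lbrakk>f \<in> Mor C X Y; f' \<in> Mor C X' Y'; f'' \<in> Mor C X'' Y''\<rbrakk> \<Longrightarrow>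
      Tns C (Otm C X X') (Otm C Y Y') X'' Y'' (Tns C X Y X' Y' f f') f'' =
      Tns C X Y (Otm C X' X'') (Otm C Y' Y'') f (Tns C X' Y' X'' Y'' f' f'')"
    and tns_unt_left: "f \<in> Mor C X Y \<Longrightarrow> Tns C (Unt C) (Unt C) X Y (Idn C (Unt C)) f = f"
    and tns_unt_right: "f \<in> Mor C X Y \<Longrightarrow> Tns C X Y (Unt C) (Unt C) f (Idn C (Unt C)) = f"
    and tns_idn: "Tns C X X Y Y (Idn C X) (Idn C Y) = Idn C (Otm C X Y)"
    and interchange: "\<lbrakk>f \<in> Mor C X Y; g \<in> Mor C Y Z; f' \<in> Mor C X' Y'; g' \<in> Mor C Y' Z'\<rbrakk> \<Longrightarrow>
      Tns C X Z X' Z' (Cmp C X Y Z g f) (Cmp C X' Y' Z' g' f') =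
      Cmp C (Otm C X X') (Otm C Y Y') (Otm C Z Z') (Tns C Y Z Y' Z' g g') (Tns C X Y X' Y' f f')"
    and tns_add_left: "\<lbrakk>f \<in> Mor C X Y; g \<in> Mor C X Y; f' \<in> Mor C X' Y'\<rbrakk> \<Longrightarrow>
      Tns C X Y X' Y' (f \<oplus>\<^bsub>Hom C X Y\<^esub> g) f' =
      Tns C X Y X' Y' f f' \<oplus>\<^bsub>Hom C (Otm C X X') (Otm C Y Y')\<^esub> Tns C X Y X' Y' g f'"
    and tns_add_right: "\<lbrakk>f \<in> Mor C X Y; f' \<in> Mor C X' Y'; g' \<in> Mor C X' Y'\<rbrakk> \<Longrightarrow>
      Tns C X Y X' Y' f (f' \<oplus>\<^bsub>Hom C X' Y'\<^esub> g') =
      Tns C X Y X' Y' f f' \<oplus>\<^bsub>Hom C (Otm C X X') (Otm C Y Y')\<^esub> Tns C X Y X' Y' f g'"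
    and tns_smult_left: "\<lbrakk>f \<in> Mor C X Y; f' \<in> Mor C X' Y'\<rbrakk> \<Longrightarrow>
      Tns C X Y X' Y' (c \<odot>\<^bsub>Hom C X Y\<^esub> f) f' =
      c \<odot>\<^bsub>Hom C (Otm C X X') (Otm C Y Y')\<^esub> Tns C X Y X' Y' f f'"
    and tns_smult_right: "\<lbrakk>f \<in> Mor C X Y; f' \<in> Mor C X' Y'\<rbrakk> \<Longrightarrow>
      Tns C X Y X' Y' f (c \<odot>\<^bsub>Hom C X' Y'\<^esub> f') =
      c \<odot>\<^bsub>Hom C (Otm C X X') (Otm C Y Y')\<^esub> Tns C X Y X' Y' f f'"

text \<open>Only one hexagon is required; the other one follows from it by symmetry.\<close>

locale symmetric_lin_moncat = strict_lin_moncat C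
  for C :: "('o, 'm, 'k::field) lin_moncat" +
  fixes br :: "'o \<Rightarrow> 'o \<Rightarrow> 'm"
  assumes br_closed: "br X Y \<in> Mor C (Otm C X Y) (Otm C Y X)"
    and br_natural: "\<lbrakk>f \<in> Mor C X Y; f' \<in> Mor C X' Y'\<rbrakk> \<Longrightarrow>
      Cmp C (Otm C X X') (Otm C Y Y') (Otm C Y' Y) (br Y Y') (Tns C X Y X' Y' f f') =
      Cmp C (Otm C X X') (Otm C X' X) (Otm C Y' Y) (Tns C X' Y' X Y f' f) (br X X')"
    and br_symmetric:
      "Cmp C (Otm C X Y) (Otm C Y X) (Otm C X Y) (br Y X) (br X Y) = Idn C (Otm C X Y)"
    and br_hexagon: "br X (Otm C Y Z) =
      Cmp C (Otm C (Otm C X Y) Z) (Otm C (Otm C Y X) Z) (Otm C (Otm C Y Z) X)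
        (Tns C Y Y (Otm C X Z) (Otm C Z X) (Idn C Y) (br X Z))
        (Tns C (Otm C X Y) (Otm C Y X) Z Z (br X Y) (Idn C Z))"

definition lie_algebra_object ::
  "('o, 'm, 'k::field) lin_moncat \<Rightarrow> ('o \<Rightarrow> 'o \<Rightarrow> 'm) \<Rightarrow> 'o \<Rightarrow> 'm \<Rightarrow> bool" where
  "lie_algebra_object C br L \<beta> \<longleftrightarrow>
    symmetric_lin_moncat C br \<and>
    (let L2 = Otm C L L; L3 = Otm C L2 L; one = Idn C L; s = br L L;
         \<beta>1 = Tns C L2 L L L \<beta> one; oneb = Tns C L L L2 L one \<beta>; ones = Tns C L L L2 L2 one s
     in \<beta> \<in> Mor C L2 L \<and>
        Cmp C L2 L2 L \<beta> s = \<ominus>\<^bsub>Hom C L2 L\<^esub> \<beta> \<and>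
        Cmp C L3 L2 L \<beta> (Cmp C L3 L3 L2 \<beta>1 ones) =
          Cmp C L3 L2 L \<beta> \<beta>1 \<ominus>\<^bsub>Hom C L3 L\<^esub> Cmp C L3 L2 L \<beta> oneb)"

text \<open>\<open>\<eta>\<close> and \<open>\<epsilon>\<close> exhibit \<open>X\<close> as a self-dual object, whose dimension \<open>\<epsilon> \<circ> \<eta>\<close> is the scalar \<open>d\<close>.\<close>

definition selfdual_of_dimension ::
  "('o, 'm, 'k::field) lin_moncat \<Rightarrow> 'o \<Rightarrow> 'm \<Rightarrow> 'm \<Rightarrow> 'k \<Rightarrow> bool" where
  "selfdual_of_dimension C X \<eta> \<epsilon> d \<longleftrightarrow>
    (let I = Unt C; X2 = Otm C X X; X3 = Otm C X2 X; one = Idn C X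
     in \<eta> \<in> Mor C I X2 \<and> \<epsilon> \<in> Mor C X2 I \<and>
        Cmp C X X3 X (Tns C X2 I X X \<epsilon> one) (Tns C X X I X2 one \<eta>) = one \<and>
        Cmp C X X3 X (Tns C X X X2 I one \<epsilon>) (Tns C I X2 X X \<eta> one) = one \<and>
        Cmp C I X2 I \<epsilon> \<eta> = d \<odot>\<^bsub>Hom C I I\<^esub> Idn C I)"

definition tensor_ideal ::
  "('o, 'm, 'k::field) lin_moncat \<Rightarrow> ('o \<Rightarrow> 'o \<Rightarrow> 'm set) \<Rightarrow> bool" where
  "tensor_ideal C I \<longleftrightarrow>
    (\<forall>Y Z. Module.submodule (I Y Z) class_ring (Hom C Y Z)) \<and>
    (\<forall>W Y Z. \<forall>f\<in>I Y Z. \<forall>g\<in>Mor C Z W. Cmp C Y Z W g f \<in> I Y W) \<and>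
    (\<forall>W Y Z. \<forall>f\<in>I Y Z. \<forall>g\<in>Mor C W Y. Cmp C W Y Z f g \<in> I W Z) \<and>
    (\<forall>W Y Z. \<forall>f\<in>I Y Z. Tns C W W Y Z (Idn C W) f \<in> I (Otm C W Y) (Otm C W Z)) \<and>
    (\<forall>W Y Z. \<forall>f\<in>I Y Z. Tns C Y Z W W f (Idn C W) \<in> I (Otm C Y W) (Otm C Z W))"

definition quot_module :: "('k, 'm) module \<Rightarrow> 'm set \<Rightarrow> ('k, 'm set) module" where
  "quot_module V W =
    \<lparr>carrier = a_rcosets\<^bsub>V\<^esub> W, mult = undefined, one = undefined, zero = W, add = set_add V,
     smult = (\<lambda>c A. \<Union>v\<in>A. W +>\<^bsub>V\<^esub> (c \<odot>\<^bsub>V\<^esub> v))\<rparr>"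

definition quot_mor ::
  "('o, 'm, 'k) lin_moncat \<Rightarrow> ('o \<Rightarrow> 'o \<Rightarrow> 'm set) \<Rightarrow> 'o \<Rightarrow> 'o \<Rightarrow> 'm \<Rightarrow> 'm set" where
  "quot_mor C I Y Z f = I Y Z +>\<^bsub>Hom C Y Z\<^esub> f"

text \<open>As for \<open>rcoset_mult\<close> in HOL-Algebra, operations on cosets are unions over representatives.\<close>

definition quot_cat ::
  "('o, 'm, 'k) lin_moncat \<Rightarrow> ('o \<Rightarrow> 'o \<Rightarrow> 'm set) \<Rightarrow> ('o, 'm set, 'k) lin_moncat" where
  "quot_cat C I =
    \<lparr>Hom = (\<lambda>Y Z. quot_module (Hom C Y Z) (I Y Z)),
     Idn = (\<lambda>Y. quot_mor C I Y Y (Idn C Y)),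
     Cmp = (\<lambda>X Y Z B A. \<Union>g\<in>B. \<Union>f\<in>A. quot_mor C I X Z (Cmp C X Y Z g f)),
     Unt = Unt C,
     Otm = Otm C,
     Tns = (\<lambda>X Y X' Y' A B. \<Union>f\<in>A. \<Union>f'\<in>B.
       quot_mor C I (Otm C X X') (Otm C Y Y') (Tns C X Y X' Y' f f'))\<rparr>"

text \<open>
  Terms for the free strict linear monoidal category on the generators. The objects are the tensor powers \<open>X\<^sup>\<otimes>\<^sup>n\<close>, represented by the natural numbers \<open>n\<close>; so
  \<open>0\<close> is the unit object, \<open>1\<close> is \<open>X\<close>, and the tensor product of objects is addition.
\<close>

datatype 'k tm =
    TId nat | TM | TS | TEta | TEps
  | TComp "'k tm" "'k tm"  (infixr \<open>\<cdot>\<close> 65)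
  | TTens "'k tm" "'k tm"  (infixr \<open>\<otimes>\<^sub>t\<close> 75)
  | TZero nat nat
  | TAdd "'k tm" "'k tm"
  | TSmul 'k "'k tm"

inductive wt :: "'k tm \<Rightarrow> nat \<Rightarrow> nat \<Rightarrow> bool" where
  "wt (TId n) n n"
| "wt TM 2 1"
| "wt TS 2 2"
| "wt TEta 0 2"
| "wt TEps 2 0"
| "\<lbrakk>wt f m n; wt g n p\<rbrakk> \<Longrightarrow> wt (g \<cdot> f) m p"
| "\<lbrakk>wt f m n; wt f' m' n'\<rbrakk> \<Longrightarrow> wt (f \<otimes>\<^sub>t f') (m + m') (n + n')"
| "wt (TZero m n) m n"
| "\<lbrakk>wt f m n; wt g m n\<rbrakk> \<Longrightarrow> wt (TAdd f g) m n"
| "wt f m n \<Longrightarrow> wt (TSmul c f) m n"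

abbreviation tone :: "'k tm" (\<open>\<I>\<close>) where
  "\<I> \<equiv> TId 1"

definition t\<sigma> :: "'k tm" where
  "t\<sigma> = (\<I> \<otimes>\<^sub>t TM) \<cdot> (TEta \<otimes>\<^sub>t \<I>)"

inductive defining_rel :: "'k::field \<Rightarrow> 'k \<Rightarrow> 'k tm \<Rightarrow> 'k tm \<Rightarrow> bool" for \<delta> \<alpha> :: 'k where
  zigzag1: "defining_rel \<delta> \<alpha> ((TEps \<otimes>\<^sub>t \<I>) \<cdot> (\<I> \<otimes>\<^sub>t TEta)) \<I>"
| zigzag2: "defining_rel \<delta> \<alpha> ((\<I> \<otimes>\<^sub>t TEps) \<cdot> (TEta \<otimes>\<^sub>t \<I>)) \<I>"
| sigma: "defining_rel \<delta> \<alpha> t\<sigma> ((TM \<otimes>\<^sub>t \<I>) \<cdot> (\<I> \<otimes>\<^sub>t TEta))"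
| eps_slide: "defining_rel \<delta> \<alpha> ((\<I> \<otimes>\<^sub>t TEps) \<cdot> (TS \<otimes>\<^sub>t \<I>)) ((TEps \<otimes>\<^sub>t \<I>) \<cdot> (\<I> \<otimes>\<^sub>t TS))"
| involution: "defining_rel \<delta> \<alpha> (TS \<cdot> TS) (\<I> \<otimes>\<^sub>t \<I>)"
| braid_rel: "defining_rel \<delta> \<alpha>
    ((TS \<otimes>\<^sub>t \<I>) \<cdot> (\<I> \<otimes>\<^sub>t TS) \<cdot> (TS \<otimes>\<^sub>t \<I>)) ((\<I> \<otimes>\<^sub>t TS) \<cdot> (TS \<otimes>\<^sub>t \<I>) \<cdot> (\<I> \<otimes>\<^sub>t TS))"
| m_slide: "defining_rel \<delta> \<alpha> ((\<I> \<otimes>\<^sub>t TM) \<cdot> (TS \<otimes>\<^sub>t \<I>) \<cdot> (\<I> \<otimes>\<^sub>t TS)) (TS \<cdot> (TM \<otimes>\<^sub>t \<I>))"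
| sigma_slide: "defining_rel \<delta> \<alpha> ((\<I> \<otimes>\<^sub>t TS) \<cdot> (TS \<otimes>\<^sub>t \<I>) \<cdot> (\<I> \<otimes>\<^sub>t t\<sigma>)) ((t\<sigma> \<otimes>\<^sub>t \<I>) \<cdot> TS)"
| eps_sym: "defining_rel \<delta> \<alpha> (TEps \<cdot> TS) TEps"
| m_skew: "defining_rel \<delta> \<alpha> (TM \<cdot> TS) (TSmul (-1) TM)"
| bigon: "defining_rel \<delta> \<alpha> (TM \<cdot> t\<sigma>) (TSmul \<alpha> \<I>)"
| loop: "defining_rel \<delta> \<alpha> (TEps \<cdot> TEta) (TSmul \<delta> (TId 0))"

text \<open>
  \<open>teq \<delta> \<alpha> m n\<close> is equality of terms \<open>X\<^sup>\<otimes>\<^sup>m \<rightarrow> X\<^sup>\<otimes>\<^sup>n\<close> in the category \<open>\<T>\<^sub>\<delta>\<^sub>,\<^sub>\<alpha>\<close>: the least congruence containing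
  the axioms of a strict linear monoidal category and the defining relations.
\<close>

inductive teq :: "'k::field \<Rightarrow> 'k \<Rightarrow> nat \<Rightarrow> nat \<Rightarrow> 'k tm \<Rightarrow> 'k tm \<Rightarrow> bool" for \<delta> \<alpha> :: 'k where
  refl: "wt f m n \<Longrightarrow> teq \<delta> \<alpha> m n f f"
| sym: "teq \<delta> \<alpha> m n f g \<Longrightarrow> teq \<delta> \<alpha> m n g f"
| trans: "\<lbrakk>teq \<delta> \<alpha> m n f g; teq \<delta> \<alpha> m n g h\<rbrakk> \<Longrightarrow> teq \<delta> \<alpha> m n f h"
| cong_comp: "\<lbrakk>teq \<delta> \<alpha> m n f f'; teq \<delta> \<alpha> n p g g'\<rbrakk> \<Longrightarrow> teq \<delta> \<alpha> m p (g \<cdot> f) (g' \<cdot> f')"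
| cong_tens: "\<lbrakk>teq \<delta> \<alpha> m n f g; teq \<delta> \<alpha> m' n' f' g'\<rbrakk> \<Longrightarrow>
    teq \<delta> \<alpha> (m + m') (n + n') (f \<otimes>\<^sub>t f') (g \<otimes>\<^sub>t g')"
| cong_add: "\<lbrakk>teq \<delta> \<alpha> m n f f'; teq \<delta> \<alpha> m n g g'\<rbrakk> \<Longrightarrow> teq \<delta> \<alpha> m n (TAdd f g) (TAdd f' g')"
| cong_smul: "teq \<delta> \<alpha> m n f g \<Longrightarrow> teq \<delta> \<alpha> m n (TSmul c f) (TSmul c g)"
| add_assoc: "\<lbrakk>wt f m n; wt g m n; wt h m n\<rbrakk> \<Longrightarrow>
    teq \<delta> \<alpha> m n (TAdd (TAdd f g) h) (TAdd f (TAdd g h))"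
| add_comm: "\<lbrakk>wt f m n; wt g m n\<rbrakk> \<Longrightarrow> teq \<delta> \<alpha> m n (TAdd f g) (TAdd g f)"
| add_zero: "wt f m n \<Longrightarrow> teq \<delta> \<alpha> m n (TAdd f (TZero m n)) f"
| add_neg: "wt f m n \<Longrightarrow> teq \<delta> \<alpha> m n (TAdd f (TSmul (-1) f)) (TZero m n)"
| smul_one: "wt f m n \<Longrightarrow> teq \<delta> \<alpha> m n (TSmul 1 f) f"
| smul_smul: "wt f m n \<Longrightarrow> teq \<delta> \<alpha> m n (TSmul c (TSmul d f)) (TSmul (c * d) f)"
| smul_add: "\<lbrakk>wt f m n; wt g m n\<rbrakk> \<Longrightarrow>
    teq \<delta> \<alpha> m n (TSmul c (TAdd f g)) (TAdd (TSmul c f) (TSmul c g))"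
| add_smul: "wt f m n \<Longrightarrow> teq \<delta> \<alpha> m n (TSmul (c + d) f) (TAdd (TSmul c f) (TSmul d f))"
| comp_assoc: "\<lbrakk>wt f m n; wt g n p; wt h p q\<rbrakk> \<Longrightarrow> teq \<delta> \<alpha> m q ((h \<cdot> g) \<cdot> f) (h \<cdot> (g \<cdot> f))"
| comp_id_left: "wt f m n \<Longrightarrow> teq \<delta> \<alpha> m n (TId n \<cdot> f) f"
| comp_id_right: "wt f m n \<Longrightarrow> teq \<delta> \<alpha> m n (f \<cdot> TId m) f"
| comp_add_left: "\<lbrakk>wt f m n; wt g n p; wt h n p\<rbrakk> \<Longrightarrow>
    teq \<delta> \<alpha> m p (TAdd g h \<cdot> f) (TAdd (g \<cdot> f) (h \<cdot> f))"
| comp_add_right: "\<lbrakk>wt f m n; wt g m n; wt h n p\<rbrakk> \<Longrightarrow>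
    teq \<delta> \<alpha> m p (h \<cdot> TAdd f g) (TAdd (h \<cdot> f) (h \<cdot> g))"
| comp_smul_left: "\<lbrakk>wt f m n; wt g n p\<rbrakk> \<Longrightarrow> teq \<delta> \<alpha> m p (TSmul c g \<cdot> f) (TSmul c (g \<cdot> f))"
| comp_smul_right: "\<lbrakk>wt f m n; wt g n p\<rbrakk> \<Longrightarrow> teq \<delta> \<alpha> m p (g \<cdot> TSmul c f) (TSmul c (g \<cdot> f))"
| tens_assoc: "\<lbrakk>wt f m n; wt f' m' n'; wt f'' m'' n''\<rbrakk> \<Longrightarrow>
    teq \<delta> \<alpha> (m + m' + m'') (n + n' + n'') ((f \<otimes>\<^sub>t f') \<otimes>\<^sub>t f'') (f \<otimes>\<^sub>t (f' \<otimes>\<^sub>t f''))"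
| tens_unit_left: "wt f m n \<Longrightarrow> teq \<delta> \<alpha> m n (TId 0 \<otimes>\<^sub>t f) f"
| tens_unit_right: "wt f m n \<Longrightarrow> teq \<delta> \<alpha> m n (f \<otimes>\<^sub>t TId 0) f"
| tens_id: "teq \<delta> \<alpha> (m + n) (m + n) (TId m \<otimes>\<^sub>t TId n) (TId (m + n))"
| interchange: "\<lbrakk>wt f m n; wt g n p; wt f' m' n'; wt g' n' p'\<rbrakk> \<Longrightarrow>
    teq \<delta> \<alpha> (m + m') (p + p') ((g \<cdot> f) \<otimes>\<^sub>t (g' \<cdot> f')) ((g \<otimes>\<^sub>t g') \<cdot> (f \<otimes>\<^sub>t f'))"
| tens_add_left: "\<lbrakk>wt f m n; wt g m n; wt h m' n'\<rbrakk> \<Longrightarrow>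
    teq \<delta> \<alpha> (m + m') (n + n') (TAdd f g \<otimes>\<^sub>t h) (TAdd (f \<otimes>\<^sub>t h) (g \<otimes>\<^sub>t h))"
| tens_add_right: "\<lbrakk>wt f m n; wt g m' n'; wt h m' n'\<rbrakk> \<Longrightarrow>
    teq \<delta> \<alpha> (m + m') (n + n') (f \<otimes>\<^sub>t TAdd g h) (TAdd (f \<otimes>\<^sub>t g) (f \<otimes>\<^sub>t h))"
| tens_smul_left: "\<lbrakk>wt f m n; wt g m' n'\<rbrakk> \<Longrightarrow>
    teq \<delta> \<alpha> (m + m') (n + n') (TSmul c f \<otimes>\<^sub>t g) (TSmul c (f \<otimes>\<^sub>t g))"
| tens_smul_right: "\<lbrakk>wt f m n; wt g m' n'\<rbrakk> \<Longrightarrow>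
    teq \<delta> \<alpha> (m + m') (n + n') (f \<otimes>\<^sub>t TSmul c g) (TSmul c (f \<otimes>\<^sub>t g))"
| relation: "\<lbrakk>defining_rel \<delta> \<alpha> f g; wt f m n; wt g m n\<rbrakk> \<Longrightarrow> teq \<delta> \<alpha> m n f g"

definition tcls :: "'k::field \<Rightarrow> 'k \<Rightarrow> nat \<Rightarrow> nat \<Rightarrow> 'k tm \<Rightarrow> 'k tm set" where
  "tcls \<delta> \<alpha> m n f = {g. teq \<delta> \<alpha> m n f g}"

definition Tcat :: "'k::field \<Rightarrow> 'k \<Rightarrow> (nat, 'k tm set, 'k) lin_moncat" where
  "Tcat \<delta> \<alpha> =
    \<lparr>Hom = (\<lambda>m n.
       \<lparr>carrier = {tcls \<delta> \<alpha> m n f | f. wt f m n}, mult = undefined, one = undefined,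
        zero = tcls \<delta> \<alpha> m n (TZero m n),
        add = (\<lambda>A B. \<Union>f\<in>A. \<Union>g\<in>B. tcls \<delta> \<alpha> m n (TAdd f g)),
        smult = (\<lambda>c A. \<Union>f\<in>A. tcls \<delta> \<alpha> m n (TSmul c f))\<rparr>),
     Idn = (\<lambda>n. tcls \<delta> \<alpha> n n (TId n)),
     Cmp = (\<lambda>m n p B A. \<Union>g\<in>B. \<Union>f\<in>A. tcls \<delta> \<alpha> m p (g \<cdot> f)),
     Unt = 0,
     Otm = (+),
     Tns = (\<lambda>m n m' n' A B. \<Union>f\<in>A. \<Union>f'\<in>B. tcls \<delta> \<alpha> (m + m') (n + n') (f \<otimes>\<^sub>t f'))\<rparr>"

text \<open>The braiding of \<open>X\<close> past \<open>X\<^sup>\<otimes>\<^sup>n\<close>, and of \<open>X\<^sup>\<otimes>\<^sup>m\<close> past \<open>X\<^sup>\<otimes>\<^sup>n\<close>, as determined by \<open>s\<close> via the hexagons.\<close>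

primrec tbraid1 :: "nat \<Rightarrow> 'k tm" where
  "tbraid1 0 = \<I>"
| "tbraid1 (Suc n) = (\<I> \<otimes>\<^sub>t tbraid1 n) \<cdot> (TS \<otimes>\<^sub>t TId n)"

primrec tbraid :: "nat \<Rightarrow> nat \<Rightarrow> 'k tm" where
  "tbraid 0 n = TId n"
| "tbraid (Suc m) n = (tbraid1 n \<otimes>\<^sub>t TId m) \<cdot> (\<I> \<otimes>\<^sub>t tbraid m n)"

definition Tbraid :: "'k::field \<Rightarrow> 'k \<Rightarrow> nat \<Rightarrow> nat \<Rightarrow> 'k tm set" where
  "Tbraid \<delta> \<alpha> m n = tcls \<delta> \<alpha> (m + n) (n + m) (tbraid m n)"

definition tK :: "'k tm" where
  "tK = t\<sigma> \<cdot> TM"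

definition tH :: "'k tm" where
  "tH = (TM \<otimes>\<^sub>t \<I>) \<cdot> (\<I> \<otimes>\<^sub>t t\<sigma>)"

definition tD :: "'k tm" where
  "tD = (TM \<otimes>\<^sub>t \<I>) \<cdot> (\<I> \<otimes>\<^sub>t TS) \<cdot> (t\<sigma> \<otimes>\<^sub>t \<I>)"

end

theory Submission
  imports Defs
begin

text \<open>
  Write \<open>U = \<eta>\<epsilon>\<close>. The idea is that \<open>1\<close>, \<open>s\<close>, \<open>U\<close> form a basis of the endomorphisms of \<open>X \<otimes> X\<close> in the
  quotient, and that the coordinates of \<open>K\<close> in this basis are forced. Three operations detect
  coordinates: composing with \<open>m\<close> sends \<open>x1 + ys + zU\<close> to \<open>(x - y)m\<close>, because \<open>ms = -m\<close> and \<open>m\<eta> = 0\<close>;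
  composing with \<open>\<epsilon>\<close> sends it to \<open>(x + y + \<delta>z)\<epsilon>\<close>; and the quarter turn of diagrams exchanges
  \<open>1\<close> and \<open>U\<close> and fixes \<open>s\<close>. If \<open>x1 + ys + zU = 0\<close>, the first and the third give \<open>x = y = z\<close>, and the
  second gives \<open>(\<delta> + 2)x = 0\<close>. This is \<open>lin_eq_zeroA\<close>; it needs \<open>m \<noteq> 0\<close> and \<open>\<epsilon> \<noteq> 0\<close>, which hold since \<open>\<alpha>\<close> is
  invertible and the quotient is not zero. As the dimension is three, \<open>K = x1 + ys + zU\<close> for some
  scalars. Now \<open>Ks = -K\<close> gives \<open>y = -x\<close> and \<open>z = 0\<close>, and \<open>mK = \<alpha>m\<close> gives \<open>2x = \<alpha>\<close>.
  That the characteristic is not two enters through \<open>m\<eta> = -m\<eta>\<close> and \<open>z = -z\<close>, and in the division of \<open>\<alpha>\<close> by two.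

  The rest follows from this formula for \<open>K\<close>. The quarter turn takes \<open>K\<close> to \<open>H\<close>, and \<open>Hs = -D\<close>, so \<open>H\<close> and
  \<open>D\<close> are known as well, and \<open>D = K - H\<close>. The partial trace of \<open>K\<close> is \<open>\<alpha>1\<close>, that of \<open>(\<alpha>/2)(1 - s)\<close> is
  \<open>(\<alpha>/2)(\<delta> - 1)1\<close>, whence \<open>\<delta> = 3\<close>. Bending the second output of \<open>D = K - H\<close> down turns this
  relation into the Jacobi identity.

  Two things make the diagrams manageable. The quotient is presented by terms just as the
  category \<open>\<T>\<close> itself, with a coarser equality (\<open>quot_Tcat_presentation\<close>), so that the monoidal
  axioms need to be checked once for both. And morphisms are handled as arrows that carry their domain
  and codomain, with whiskering in place of the tensor product; then a diagram is a composite of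
  layers \<open>1 \<otimes> g \<otimes> 1\<close>, and a planar isotopy is a rewriting of such composites.
  That the quotient is symmetric is shown by induction over terms: every generator slides past
  a strand, and this property passes to composites and tensor products.
\<close>

lemma UN_const_eq:
  assumes "a \<in> A" "\<And>x. x \<in> A \<Longrightarrow> F x = B"
  shows "(\<Union>x\<in>A. F x) = B"
  using assms by blast

lemma UN2_const_eq:
  assumes "a \<in> A" "b \<in> B" "\<And>x y. \<lbrakk>x \<in> A; y \<in> B\<rbrakk> \<Longrightarrow> F x y = D"
  shows "(\<Union>x\<in>A. \<Union>y\<in>B. F x y) = D"
  using assms by blast

section \<open>Categories presented by terms\<close>

lemma class_vectorspaceI:
  assumes "Module.module (class_ring :: 'k::field ring) V"
  shows "vectorspace (class_ring :: 'k ring) V"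
  using assms class_field by (simp add: vectorspace_def)

text \<open>
  A category whose morphisms \<open>X\<^sup>\<otimes>\<^sup>m \<rightarrow> X\<^sup>\<otimes>\<^sup>n\<close> are named by terms. The assumption \<open>eqI\<close> only asks that terms
  equal in \<open>\<T>\<close> name the same morphism, so that quotients of \<open>\<T>\<close> are covered; that equality of names is
  a congruence is automatic, since the operations are functions of the morphisms.
\<close>

locale term_presentation =
  fixes \<delta> \<alpha> :: "'k::field" and C :: "(nat, 'm, 'k) lin_moncat"
    and P :: "nat \<Rightarrow> nat \<Rightarrow> 'k tm \<Rightarrow> 'm"
  assumes mor: "Mor C m n = {P m n f | f. wt f m n}"
    and zero: "\<zero>\<^bsub>Hom C m n\<^esub> = P m n (TZero m n)"
    and add: "\<lbrakk>wt f m n; wt g m n\<rbrakk> \<Longrightarrow> P m n f \<oplus>\<^bsub>Hom C m n\<^esub> P m n g = P m n (TAdd f g)"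
    and smult: "wt f m n \<Longrightarrow> c \<odot>\<^bsub>Hom C m n\<^esub> P m n f = P m n (TSmul c f)"
    and idn: "Idn C n = P n n (TId n)"
    and cmp: "\<lbrakk>wt f m n; wt g n p\<rbrakk> \<Longrightarrow> Cmp C m n p (P n p g) (P m n f) = P m p (g \<cdot> f)"
    and unt: "Unt C = 0"
    and otm: "Otm C = (+)"
    and tns: "\<lbrakk>wt f m n; wt f' m' n'\<rbrakk> \<Longrightarrow>
      Tns C m n m' n' (P m n f) (P m' n' f') = P (m + m') (n + n') (f \<otimes>\<^sub>t f')"
    and eqI: "teq \<delta> \<alpha> m n f g \<Longrightarrow> P m n f = P m n g"
begin

lemma mor_cases:
  assumes "f \<in> Mor C m n"
  obtains t where "wt t m n" "f = P m n t"
  using assms mor by auto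

lemma mor_I: "wt t m n \<Longrightarrow> P m n t \<in> Mor C m n"
  using mor by auto

lemma hom_abelian_group: "abelian_group (Hom C m n)"
proof (rule abelian_groupI)
  show "\<And>x y. \<lbrakk>x \<in> Mor C m n; y \<in> Mor C m n\<rbrakk> \<Longrightarrow> x \<oplus>\<^bsub>Hom C m n\<^esub> y \<in> Mor C m n"
    by (auto elim!: mor_cases simp: add intro!: mor_I wt.intros)
  show "\<zero>\<^bsub>Hom C m n\<^esub> \<in> Mor C m n"
    by (auto simp: zero intro!: mor_I wt.intros)
  show "x \<oplus>\<^bsub>Hom C m n\<^esub> y \<oplus>\<^bsub>Hom C m n\<^esub> z = x \<oplus>\<^bsub>Hom C m n\<^esub> (y \<oplus>\<^bsub>Hom C m n\<^esub> z)"
    if "x \<in> Mor C m n" "y \<in> Mor C m n" "z \<in> Mor C m n" for x y z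
    using that by (auto elim!: mor_cases simp: add wt.intros intro!: eqI teq.add_assoc)
  show "x \<oplus>\<^bsub>Hom C m n\<^esub> y = y \<oplus>\<^bsub>Hom C m n\<^esub> x" if "x \<in> Mor C m n" "y \<in> Mor C m n" for x y
    using that by (auto elim!: mor_cases simp: add intro!: eqI teq.add_comm)
  have zero_right: "P m n f \<oplus>\<^bsub>Hom C m n\<^esub> \<zero>\<^bsub>Hom C m n\<^esub> = P m n f" if "wt f m n" for f
    using that by (auto simp: add zero wt.intros intro!: eqI teq.add_zero)
  show "\<zero>\<^bsub>Hom C m n\<^esub> \<oplus>\<^bsub>Hom C m n\<^esub> x = x" if "x \<in> Mor C m n" for x
    using that
  proof (elim mor_cases)
    fix t assume t: "wt t m n" "x = P m n t"
    have "\<zero>\<^bsub>Hom C m n\<^esub> \<oplus>\<^bsub>Hom C m n\<^esub> P m n t = P m n t \<oplus>\<^bsub>Hom C m n\<^esub> \<zero>\<^bsub>Hom C m n\<^esub>"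
      using t by (auto simp: add zero wt.intros intro!: eqI teq.add_comm)
    then show ?thesis using t zero_right by simp
  qed
  show "\<exists>y\<in>Mor C m n. y \<oplus>\<^bsub>Hom C m n\<^esub> x = \<zero>\<^bsub>Hom C m n\<^esub>" if "x \<in> Mor C m n" for x
    using that
  proof (elim mor_cases)
    fix t assume t: "wt t m n" "x = P m n t"
    have "P m n (TSmul (-1) t) \<oplus>\<^bsub>Hom C m n\<^esub> P m n t = \<zero>\<^bsub>Hom C m n\<^esub>"
      using t eqI[OF teq.trans[OF teq.add_comm teq.add_neg]] by (simp add: add zero wt.intros)
    then show ?thesis using t by (blast intro: mor_I wt.intros)
  qed
qed

lemma hom_vectorspace: "vectorspace class_ring (Hom C m n)"
proof (rule class_vectorspaceI, rule moduleI)
  show "cring (class_ring :: 'k ring)" ..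
  show "abelian_group (Hom C m n)" by (rule hom_abelian_group)
  fix a b :: 'k and x y
  assume "x \<in> Mor C m n" "y \<in> Mor C m n"
  then obtain f g where f: "wt f m n" "x = P m n f" and g: "wt g m n" "y = P m n g"
    by (elim mor_cases)
  have [simp]: "carrier class_ring = (UNIV :: 'k set)" by simp
  show "a \<odot>\<^bsub>Hom C m n\<^esub> x \<in> Mor C m n"
    using f by (simp add: smult mor_I wt.intros)
  show "(a \<oplus>\<^bsub>class_ring\<^esub> b) \<odot>\<^bsub>Hom C m n\<^esub> x = a \<odot>\<^bsub>Hom C m n\<^esub> x \<oplus>\<^bsub>Hom C m n\<^esub> b \<odot>\<^bsub>Hom C m n\<^esub> x"
    using f by (simp add: smult add wt.intros eqI[OF teq.add_smul])
  show "a \<odot>\<^bsub>Hom C m n\<^esub> (x \<oplus>\<^bsub>Hom C m n\<^esub> y) = a \<odot>\<^bsub>Hom C m n\<^esub> x \<oplus>\<^bsub>Hom C m n\<^esub> a \<odot>\<^bsub>Hom C m n\<^esub> y"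
    using f g by (simp add: smult add wt.intros eqI[OF teq.smul_add])
  show "(a \<otimes>\<^bsub>class_ring\<^esub> b) \<odot>\<^bsub>Hom C m n\<^esub> x = a \<odot>\<^bsub>Hom C m n\<^esub> (b \<odot>\<^bsub>Hom C m n\<^esub> x)"
    using f by (simp add: smult wt.intros eqI[OF teq.smul_smul])
  show "\<one>\<^bsub>class_ring\<^esub> \<odot>\<^bsub>Hom C m n\<^esub> x = x"
    using f by (simp add: smult eqI[OF teq.smul_one])
qed

lemmas presented = unt otm idn cmp tns add smult wt.intros mor_I

text \<open>
  Each axiom is one of the rules generating \<open>teq\<close>, read through the naming of morphisms.
\<close>

lemma strict_lin_moncat: "strict_lin_moncat C"
proof (rule strict_lin_moncat.intro)
  show "vectorspace class_ring (Hom C X Y)" for X Y by (rule hom_vectorspace)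
next
  fix X Y Z W X' Y' Z' X'' Y'' :: nat and f g h f' g' f'' :: 'm and c :: 'k
  show "Idn C X \<in> Mor C X X"
    by (simp add: presented)
  show "Cmp C X Y Z g f \<in> Mor C X Z"
    if "f \<in> Mor C X Y" "g \<in> Mor C Y Z"
    using that by (elim mor_cases) (simp add: presented)
  show "Cmp C X Y Y (Idn C Y) f = f"
    if "f \<in> Mor C X Y"
    using that by (elim mor_cases) (simp add: presented eqI[OF teq.comp_id_left])
  show "Cmp C X X Y f (Idn C X) = f"
    if "f \<in> Mor C X Y"
    using that by (elim mor_cases) (simp add: presented eqI[OF teq.comp_id_right])
  show "Cmp C W X Z (Cmp C X Y Z h g) f = Cmp C W Y Z h (Cmp C W X Y g f)"
    if "f \<in> Mor C W X" "g \<in> Mor C X Y" "h \<in> Mor C Y Z"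
    using that by (elim mor_cases) (simp add: presented eqI[OF teq.comp_assoc])
  show "Cmp C X Y Z (g \<oplus>\<^bsub>Hom C Y Z\<^esub> g') f = Cmp C X Y Z g f \<oplus>\<^bsub>Hom C X Z\<^esub> Cmp C X Y Z g' f"
    if "f \<in> Mor C X Y" "g \<in> Mor C Y Z" "g' \<in> Mor C Y Z"
    using that by (elim mor_cases) (simp add: presented eqI[OF teq.comp_add_left])
  show "Cmp C X Y Z g (f \<oplus>\<^bsub>Hom C X Y\<^esub> f') = Cmp C X Y Z g f \<oplus>\<^bsub>Hom C X Z\<^esub> Cmp C X Y Z g f'"
    if "f \<in> Mor C X Y" "f' \<in> Mor C X Y" "g \<in> Mor C Y Z"
    using that by (elim mor_cases) (simp add: presented eqI[OF teq.comp_add_right])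
  show "Cmp C X Y Z (c \<odot>\<^bsub>Hom C Y Z\<^esub> g) f = c \<odot>\<^bsub>Hom C X Z\<^esub> Cmp C X Y Z g f"
    if "f \<in> Mor C X Y" "g \<in> Mor C Y Z"
    using that by (elim mor_cases) (simp add: presented eqI[OF teq.comp_smul_left])
  show "Cmp C X Y Z g (c \<odot>\<^bsub>Hom C X Y\<^esub> f) = c \<odot>\<^bsub>Hom C X Z\<^esub> Cmp C X Y Z g f"
    if "f \<in> Mor C X Y" "g \<in> Mor C Y Z"
    using that by (elim mor_cases) (simp add: presented eqI[OF teq.comp_smul_right])
  show "Otm C (Otm C X Y) Z = Otm C X (Otm C Y Z)"
    by (simp add: presented)
  show "Otm C (Unt C) X = X"
    by (simp add: presented)
  show "Otm C X (Unt C) = X"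
    by (simp add: presented)
  show "Tns C X Y X' Y' f f' \<in> Mor C (Otm C X X') (Otm C Y Y')"
    if "f \<in> Mor C X Y" "f' \<in> Mor C X' Y'"
    using that by (elim mor_cases) (simp add: presented)
  show "Tns C (Otm C X X') (Otm C Y Y') X'' Y'' (Tns C X Y X' Y' f f') f'' =
      Tns C X Y (Otm C X' X'') (Otm C Y' Y'') f (Tns C X' Y' X'' Y'' f' f'')"
    if "f \<in> Mor C X Y" "f' \<in> Mor C X' Y'" "f'' \<in> Mor C X'' Y''"
    using that by (elim mor_cases) (simp add: presented eqI[OF teq.tens_assoc, unfolded add.assoc] add.assoc)
  show "Tns C (Unt C) (Unt C) X Y (Idn C (Unt C)) f = f"
    if "f \<in> Mor C X Y"
    using that by (elim mor_cases) (simp add: presented tns[of _ 0 0, simplified] eqI[OF teq.tens_unit_left])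
  show "Tns C X Y (Unt C) (Unt C) f (Idn C (Unt C)) = f"
    if "f \<in> Mor C X Y"
    using that by (elim mor_cases) (simp add: presented tns[of _ _ _ _ 0 0, simplified] eqI[OF teq.tens_unit_right])
  show "Tns C X X Y Y (Idn C X) (Idn C Y) = Idn C (Otm C X Y)"
    by (simp add: presented eqI[OF teq.tens_id])
  show "Tns C X Z X' Z' (Cmp C X Y Z g f) (Cmp C X' Y' Z' g' f') =
      Cmp C (Otm C X X') (Otm C Y Y') (Otm C Z Z') (Tns C Y Z Y' Z' g g') (Tns C X Y X' Y' f f')"
    if "f \<in> Mor C X Y" "g \<in> Mor C Y Z" "f' \<in> Mor C X' Y'" "g' \<in> Mor C Y' Z'"
    using that by (elim mor_cases) (simp add: presented eqI[OF teq.interchange])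
  show "Tns C X Y X' Y' (f \<oplus>\<^bsub>Hom C X Y\<^esub> g) f' =
      Tns C X Y X' Y' f f' \<oplus>\<^bsub>Hom C (Otm C X X') (Otm C Y Y')\<^esub> Tns C X Y X' Y' g f'"
    if "f \<in> Mor C X Y" "g \<in> Mor C X Y" "f' \<in> Mor C X' Y'"
    using that by (elim mor_cases) (simp add: presented eqI[OF teq.tens_add_left])
  show "Tns C X Y X' Y' f (f' \<oplus>\<^bsub>Hom C X' Y'\<^esub> g') =
      Tns C X Y X' Y' f f' \<oplus>\<^bsub>Hom C (Otm C X X') (Otm C Y Y')\<^esub> Tns C X Y X' Y' f g'"
    if "f \<in> Mor C X Y" "f' \<in> Mor C X' Y'" "g' \<in> Mor C X' Y'"
    using that by (elim mor_cases) (simp add: presented eqI[OF teq.tens_add_right])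
  show "Tns C X Y X' Y' (c \<odot>\<^bsub>Hom C X Y\<^esub> f) f' =
      c \<odot>\<^bsub>Hom C (Otm C X X') (Otm C Y Y')\<^esub> Tns C X Y X' Y' f f'"
    if "f \<in> Mor C X Y" "f' \<in> Mor C X' Y'"
    using that by (elim mor_cases) (simp add: presented eqI[OF teq.tens_smul_left])
  show "Tns C X Y X' Y' f (c \<odot>\<^bsub>Hom C X' Y'\<^esub> f') =
      c \<odot>\<^bsub>Hom C (Otm C X X') (Otm C Y Y')\<^esub> Tns C X Y X' Y' f f'"
    if "f \<in> Mor C X Y" "f' \<in> Mor C X' Y'"
    using that by (elim mor_cases) (simp add: presented eqI[OF teq.tens_smul_right])
qed

end

section \<open>The category \<open>\<T>\<close> as presented category\<close>

lemma tcls_eqI: "teq \<delta> \<alpha> m n f g \<Longrightarrow> tcls \<delta> \<alpha> m n f = tcls \<delta> \<alpha> m n g"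
  unfolding tcls_def by (blast intro: teq.sym teq.trans)

lemma Tcat_presentation: "term_presentation \<delta> \<alpha> (Tcat \<delta> \<alpha>) (tcls \<delta> \<alpha>)"
proof
  have self: "f \<in> tcls \<delta> \<alpha> m n f" if "wt f m n" for f m n
    using that by (simp add: tcls_def teq.refl)
  have rep: "teq \<delta> \<alpha> m n g f" if "g \<in> tcls \<delta> \<alpha> m n f" for f g m n
    using that by (simp add: tcls_def teq.sym)
  fix m n p m' n' :: nat and f g f' :: "'a tm" and c
  show "tcls \<delta> \<alpha> m n f \<oplus>\<^bsub>Hom (Tcat \<delta> \<alpha>) m n\<^esub> tcls \<delta> \<alpha> m n g = tcls \<delta> \<alpha> m n (TAdd f g)"
    if "wt f m n" "wt g m n"
    unfolding Tcat_def using that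
    by (simp, intro UN2_const_eq[OF self self] tcls_eqI teq.cong_add rep)
  show "c \<odot>\<^bsub>Hom (Tcat \<delta> \<alpha>) m n\<^esub> tcls \<delta> \<alpha> m n f = tcls \<delta> \<alpha> m n (TSmul c f)" if "wt f m n"
    unfolding Tcat_def using that
    by (simp, intro UN_const_eq[OF self] tcls_eqI teq.cong_smul rep)
  show "Cmp (Tcat \<delta> \<alpha>) m n p (tcls \<delta> \<alpha> n p g) (tcls \<delta> \<alpha> m n f) = tcls \<delta> \<alpha> m p (g \<cdot> f)"
    if "wt f m n" "wt g n p"
    unfolding Tcat_def using that
    by (simp, intro UN2_const_eq[OF self self] tcls_eqI teq.cong_comp rep)
  show "Tns (Tcat \<delta> \<alpha>) m n m' n' (tcls \<delta> \<alpha> m n f) (tcls \<delta> \<alpha> m' n' f') =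
      tcls \<delta> \<alpha> (m + m') (n + n') (f \<otimes>\<^sub>t f')" if "wt f m n" "wt f' m' n'"
    unfolding Tcat_def using that
    by (simp, intro UN2_const_eq[OF self self] tcls_eqI teq.cong_tens rep)
qed (auto simp: Tcat_def tcls_eqI)

section \<open>Quotients by tensor ideals\<close>

context strict_lin_moncat
begin

lemma hom_module: "Module.module class_ring (Hom C Y Z)"
  using hom_vs[of Y Z] by (simp add: vectorspace_def)

lemma hom_group: "abelian_group (Hom C Y Z)"
  using hom_module[of Y Z] by (rule Module.module.axioms(2))

lemmas hom_add_closed = abelian_groupE(1)[OF hom_group]
  and hom_zero_closed = abelian_groupE(2)[OF hom_group]
  and hom_add_assoc = abelian_groupE(3)[OF hom_group]
  and hom_add_comm = abelian_groupE(4)[OF hom_group]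
  and hom_add_zero_left = abelian_groupE(5)[OF hom_group]

lemma hom_smult_closed: "f \<in> Mor C Y Z \<Longrightarrow> c \<odot>\<^bsub>Hom C Y Z\<^esub> f \<in> Mor C Y Z"
  using Module.module.smult_closed[OF hom_module] by simp

lemma hom_smult_add: "\<lbrakk>f \<in> Mor C Y Z; g \<in> Mor C Y Z\<rbrakk> \<Longrightarrow>
    c \<odot>\<^bsub>Hom C Y Z\<^esub> (f \<oplus>\<^bsub>Hom C Y Z\<^esub> g) = c \<odot>\<^bsub>Hom C Y Z\<^esub> f \<oplus>\<^bsub>Hom C Y Z\<^esub> c \<odot>\<^bsub>Hom C Y Z\<^esub> g"
  using Module.module.smult_r_distr[OF hom_module] by simp

lemma hom_add_smult: "f \<in> Mor C Y Z \<Longrightarrow>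
    (c + d) \<odot>\<^bsub>Hom C Y Z\<^esub> f = c \<odot>\<^bsub>Hom C Y Z\<^esub> f \<oplus>\<^bsub>Hom C Y Z\<^esub> d \<odot>\<^bsub>Hom C Y Z\<^esub> f"
  using Module.module.smult_l_distr[OF hom_module, of c d f] by simp

lemma hom_smult_smult: "f \<in> Mor C Y Z \<Longrightarrow>
    c \<odot>\<^bsub>Hom C Y Z\<^esub> (d \<odot>\<^bsub>Hom C Y Z\<^esub> f) = (c * d) \<odot>\<^bsub>Hom C Y Z\<^esub> f"
  using Module.module.smult_assoc1[OF hom_module, of c d f] by simp

lemma hom_smult_one: "f \<in> Mor C Y Z \<Longrightarrow> 1 \<odot>\<^bsub>Hom C Y Z\<^esub> f = f"
  using Module.module.smult_one[OF hom_module, of f] by simp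

lemma hom_smult_zero: "f \<in> Mor C Y Z \<Longrightarrow> 0 \<odot>\<^bsub>Hom C Y Z\<^esub> f = \<zero>\<^bsub>Hom C Y Z\<^esub>"
  using Module.module.smult_l_null[OF hom_module, of f] by simp

lemma hom_smult_zero_right: "c \<odot>\<^bsub>Hom C Y Z\<^esub> \<zero>\<^bsub>Hom C Y Z\<^esub> = \<zero>\<^bsub>Hom C Y Z\<^esub>"
  using Module.module.smult_r_null[OF hom_module, of c] by simp

lemma hom_neg: "f \<in> Mor C Y Z \<Longrightarrow> \<ominus>\<^bsub>Hom C Y Z\<^esub> f = (-1) \<odot>\<^bsub>Hom C Y Z\<^esub> f"
  using Module.module.smult_l_minus[OF hom_module, of 1 f] by (simp add: hom_smult_one class_ring_simps)

end

locale tensor_ideal_quotient = strict_lin_moncat C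
  for C :: "('o, 'm, 'k::field) lin_moncat" +
  fixes I :: "'o \<Rightarrow> 'o \<Rightarrow> 'm set"
  assumes ideal: "tensor_ideal C I"
begin

lemma ideal_submodule: "Module.submodule (I Y Z) class_ring (Hom C Y Z)"
  using ideal by (simp add: tensor_ideal_def)

lemma ideal_subgroup: "abelian_subgroup (I Y Z) (Hom C Y Z)"
  using ideal_submodule[of Y Z] hom_group[of Y Z]
  by (auto intro!: abelian_subgroupI3 simp: additive_subgroup_def Module.submodule_def)

lemma ideal_mor: "f \<in> I Y Z \<Longrightarrow> f \<in> Mor C Y Z"
  using additive_subgroup.a_subset[OF abelian_subgroup.axioms(1)[OF ideal_subgroup]] by blast

lemma ideal_smult: "f \<in> I Y Z \<Longrightarrow> c \<odot>\<^bsub>Hom C Y Z\<^esub> f \<in> I Y Z"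
  using Module.submodule.smult_closed[OF ideal_submodule] by simp

lemma ideal_cmp_left: "\<lbrakk>f \<in> I X Y; g \<in> Mor C Y Z\<rbrakk> \<Longrightarrow> Cmp C X Y Z g f \<in> I X Z"
  using ideal by (simp add: tensor_ideal_def)

lemma ideal_cmp_right: "\<lbrakk>f \<in> Mor C X Y; g \<in> I Y Z\<rbrakk> \<Longrightarrow> Cmp C X Y Z g f \<in> I X Z"
  using ideal by (simp add: tensor_ideal_def)

lemma ideal_whisker_left: "f \<in> I Y Z \<Longrightarrow> Tns C W W Y Z (Idn C W) f \<in> I (Otm C W Y) (Otm C W Z)"
  using ideal by (simp add: tensor_ideal_def)

lemma ideal_whisker_right: "f \<in> I Y Z \<Longrightarrow> Tns C Y Z W W f (Idn C W) \<in> I (Otm C Y W) (Otm C Z W)"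
  using ideal by (simp add: tensor_ideal_def)

text \<open>
  Tensoring with an arbitrary \<open>g\<close> reduces to the closure properties of an ideal, because
  \<open>f \<otimes> g = (1 \<otimes> g)(f \<otimes> 1)\<close>.
\<close>

lemma ideal_tns_left:
  assumes f: "f \<in> I X Y" and g: "g \<in> Mor C X' Y'"
  shows "Tns C X Y X' Y' f g \<in> I (Otm C X X') (Otm C Y Y')"
proof -
  have "Tns C X Y X' Y' f g =
      Tns C X Y X' Y' (Cmp C X Y Y (Idn C Y) f) (Cmp C X' X' Y' g (Idn C X'))"
    using f g by (simp add: cmp_idn_left cmp_idn_right ideal_mor)
  also have "\<dots> = Cmp C (Otm C X X') (Otm C Y X') (Otm C Y Y')
      (Tns C Y Y X' Y' (Idn C Y) g) (Tns C X Y X' X' f (Idn C X'))"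
    using f g by (intro interchange idn_closed) (auto intro: ideal_mor)
  also have "\<dots> \<in> I (Otm C X X') (Otm C Y Y')"
    using f g by (intro ideal_cmp_left[OF ideal_whisker_right tns_closed[OF idn_closed]])
  finally show ?thesis .
qed

lemma ideal_tns_right:
  assumes f: "f \<in> Mor C X Y" and g: "g \<in> I X' Y'"
  shows "Tns C X Y X' Y' f g \<in> I (Otm C X X') (Otm C Y Y')"
proof -
  have "Tns C X Y X' Y' f g =
      Tns C X Y X' Y' (Cmp C X Y Y (Idn C Y) f) (Cmp C X' X' Y' g (Idn C X'))"
    using f g by (simp add: cmp_idn_left cmp_idn_right ideal_mor)
  also have "\<dots> = Cmp C (Otm C X X') (Otm C Y X') (Otm C Y Y')
      (Tns C Y Y X' Y' (Idn C Y) g) (Tns C X Y X' X' f (Idn C X'))"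
    using f g by (intro interchange idn_closed) (auto intro: ideal_mor)
  also have "\<dots> \<in> I (Otm C X X') (Otm C Y Y')"
    using f g by (intro ideal_cmp_right[OF tns_closed[OF _ idn_closed] ideal_whisker_left])
  finally show ?thesis .
qed

lemma in_coset_iff: "g \<in> quot_mor C I Y Z f \<longleftrightarrow> (\<exists>h\<in>I Y Z. g = h \<oplus>\<^bsub>Hom C Y Z\<^esub> f)"
  by (auto simp: quot_mor_def a_r_coset_def')

lemma rep_in_coset: "f \<in> Mor C Y Z \<Longrightarrow> f \<in> quot_mor C I Y Z f"
  using abelian_subgroup.a_rcos_self[OF ideal_subgroup] by (simp add: quot_mor_def)

lemma coset_shift:
  assumes "h \<in> I Y Z" "f \<in> Mor C Y Z"
  shows "quot_mor C I Y Z (h \<oplus>\<^bsub>Hom C Y Z\<^esub> f) = quot_mor C I Y Z f"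
proof -
  interpret abelian_subgroup "I Y Z" "Hom C Y Z" by (rule ideal_subgroup)
  show ?thesis
    using assms a_subgroup unfolding quot_mor_def
    by (intro a_repr_independence[symmetric]) (auto simp: a_r_coset_def')
qed

lemma quot_carrier: "Mor (quot_cat C I) Y Z = quot_mor C I Y Z ` Mor C Y Z"
  by (auto simp: quot_cat_def quot_module_def A_RCOSETS_def' quot_mor_def)

lemma quot_zero: "\<zero>\<^bsub>Hom (quot_cat C I) Y Z\<^esub> = quot_mor C I Y Z \<zero>\<^bsub>Hom C Y Z\<^esub>"
  using abelian_group.a_coset_add_zero[OF hom_group] ideal_mor
  by (auto simp: quot_cat_def quot_module_def quot_mor_def subset_iff)

lemma quot_add:
  assumes "f \<in> Mor C Y Z" "g \<in> Mor C Y Z"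
  shows "quot_mor C I Y Z f \<oplus>\<^bsub>Hom (quot_cat C I) Y Z\<^esub> quot_mor C I Y Z g =
    quot_mor C I Y Z (f \<oplus>\<^bsub>Hom C Y Z\<^esub> g)"
  using abelian_subgroup.a_rcos_sum[OF ideal_subgroup] assms
  by (simp add: quot_cat_def quot_module_def quot_mor_def)

lemma quot_smult:
  assumes f: "f \<in> Mor C Y Z"
  shows "c \<odot>\<^bsub>Hom (quot_cat C I) Y Z\<^esub> quot_mor C I Y Z f = quot_mor C I Y Z (c \<odot>\<^bsub>Hom C Y Z\<^esub> f)"
proof -
  interpret Module.module class_ring "Hom C Y Z" by (rule hom_module)
  have "(\<Union>v\<in>quot_mor C I Y Z f. quot_mor C I Y Z (c \<odot>\<^bsub>Hom C Y Z\<^esub> v)) =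
      quot_mor C I Y Z (c \<odot>\<^bsub>Hom C Y Z\<^esub> f)"
  proof (rule UN_const_eq[OF rep_in_coset[OF f]])
    fix v assume "v \<in> quot_mor C I Y Z f"
    then obtain h where h: "h \<in> I Y Z" "v = h \<oplus>\<^bsub>Hom C Y Z\<^esub> f" by (auto simp: in_coset_iff)
    then show "quot_mor C I Y Z (c \<odot>\<^bsub>Hom C Y Z\<^esub> v) = quot_mor C I Y Z (c \<odot>\<^bsub>Hom C Y Z\<^esub> f)"
      using f coset_shift[OF ideal_smult[OF h(1)]] by (simp add: smult_r_distr ideal_mor)
  qed
  then show ?thesis by (simp add: quot_cat_def quot_module_def quot_mor_def)
qed

lemma quot_cmp:
  assumes f: "f \<in> Mor C X Y" and g: "g \<in> Mor C Y Z"
  shows "Cmp (quot_cat C I) X Y Z (quot_mor C I Y Z g) (quot_mor C I X Y f) =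
    quot_mor C I X Z (Cmp C X Y Z g f)"
proof -
  have "(\<Union>g'\<in>quot_mor C I Y Z g. \<Union>f'\<in>quot_mor C I X Y f. quot_mor C I X Z (Cmp C X Y Z g' f')) =
      quot_mor C I X Z (Cmp C X Y Z g f)"
  proof (rule UN2_const_eq[OF rep_in_coset[OF g] rep_in_coset[OF f]])
    fix g' f' assume "g' \<in> quot_mor C I Y Z g" "f' \<in> quot_mor C I X Y f"
    then obtain h k where h: "h \<in> I Y Z" "g' = h \<oplus>\<^bsub>Hom C Y Z\<^esub> g"
      and k: "k \<in> I X Y" "f' = k \<oplus>\<^bsub>Hom C X Y\<^esub> f" by (auto simp: in_coset_iff)
    have f': "f' \<in> Mor C X Y" using f k by (simp add: hom_add_closed ideal_mor)
    have "quot_mor C I X Z (Cmp C X Y Z g' f') = quot_mor C I X Z (Cmp C X Y Z g f')"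
      using f' g h by (simp add: cmp_add_left ideal_mor coset_shift ideal_cmp_right cmp_closed)
    also have "\<dots> = quot_mor C I X Z (Cmp C X Y Z g f)"
      using f g k by (simp add: cmp_add_right ideal_mor coset_shift ideal_cmp_left cmp_closed)
    finally show "quot_mor C I X Z (Cmp C X Y Z g' f') = quot_mor C I X Z (Cmp C X Y Z g f)" .
  qed
  then show ?thesis by (simp add: quot_cat_def)
qed

lemma quot_tns:
  assumes f: "f \<in> Mor C X Y" and g: "g \<in> Mor C X' Y'"
  shows "Tns (quot_cat C I) X Y X' Y' (quot_mor C I X Y f) (quot_mor C I X' Y' g) =
    quot_mor C I (Otm C X X') (Otm C Y Y') (Tns C X Y X' Y' f g)" (is "_ = ?q (Tns C X Y X' Y' f g)")
proof -
  have "(\<Union>f'\<in>quot_mor C I X Y f. \<Union>g'\<in>quot_mor C I X' Y' g. ?q (Tns C X Y X' Y' f' g')) =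
      ?q (Tns C X Y X' Y' f g)"
  proof (rule UN2_const_eq[OF rep_in_coset[OF f] rep_in_coset[OF g]])
    fix f' g' assume "f' \<in> quot_mor C I X Y f" "g' \<in> quot_mor C I X' Y' g"
    then obtain h k where h: "h \<in> I X' Y'" "g' = h \<oplus>\<^bsub>Hom C X' Y'\<^esub> g"
      and k: "k \<in> I X Y" "f' = k \<oplus>\<^bsub>Hom C X Y\<^esub> f" by (auto simp: in_coset_iff)
    have f': "f' \<in> Mor C X Y" using f k by (simp add: hom_add_closed ideal_mor)
    have "?q (Tns C X Y X' Y' f' g') = ?q (Tns C X Y X' Y' f' g)"
      using f' g h by (simp add: tns_add_right ideal_mor coset_shift ideal_tns_right tns_closed)
    also have "\<dots> = ?q (Tns C X Y X' Y' f g)"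
      using f g k by (simp add: tns_add_left ideal_mor coset_shift ideal_tns_left tns_closed)
    finally show "?q (Tns C X Y X' Y' f' g') = ?q (Tns C X Y X' Y' f g)" .
  qed
  then show ?thesis by (simp add: quot_cat_def)
qed

end

text \<open>
  The structure of the quotient is given by unions over representatives; the lemmas above evaluate
  these on cosets, and thereby on names of morphisms.
\<close>

lemma quot_Tcat_presentation:
  assumes "tensor_ideal (Tcat \<delta> \<alpha>) J"
  shows "term_presentation \<delta> \<alpha> (quot_cat (Tcat \<delta> \<alpha>) J)
    (\<lambda>m n f. quot_mor (Tcat \<delta> \<alpha>) J m n (tcls \<delta> \<alpha> m n f))"
proof -
  interpret T: term_presentation \<delta> \<alpha> "Tcat \<delta> \<alpha>" "tcls \<delta> \<alpha>" by (rule Tcat_presentation)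
  interpret strict_lin_moncat "Tcat \<delta> \<alpha>" by (rule T.strict_lin_moncat)
  interpret tensor_ideal_quotient "Tcat \<delta> \<alpha>" J by unfold_locales (rule assms)
  show ?thesis
  proof
    show "Mor (quot_cat (Tcat \<delta> \<alpha>) J) m n =
        {quot_mor (Tcat \<delta> \<alpha>) J m n (tcls \<delta> \<alpha> m n f) | f. wt f m n}" for m n
      by (auto simp: quot_carrier T.mor)
    show "Unt (quot_cat (Tcat \<delta> \<alpha>) J) = 0" "Otm (quot_cat (Tcat \<delta> \<alpha>) J) = (+)"
      "Idn (quot_cat (Tcat \<delta> \<alpha>) J) n = quot_mor (Tcat \<delta> \<alpha>) J n n (tcls \<delta> \<alpha> n n (TId n))" for n
      by (simp_all add: quot_cat_def T.unt T.otm T.idn)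
  qed (simp_all add: quot_zero T.zero quot_add T.add quot_smult T.smult quot_cmp T.cmp
      quot_tns[unfolded T.otm] T.tns T.mor_I T.eqI)
qed

section \<open>Arrows between tensor powers\<close>

text \<open>
  Composing morphisms in a hom-indexed category requires naming three objects at every step. An
  arrow records its own domain and codomain instead. The operations below are total: they return
  \<open>Undef\<close> when the objects do not match or a representative is not a morphism. Thereby most laws hold
  without any hypothesis, as both sides are undefined together, and can be used as plain rewrite rules.
\<close>

datatype 'm arrow = Undef | Arr (dm: nat) (cd: nat) (rep: 'm)

locale tensor_powers = strict_lin_moncat C
  for C :: "(nat, 'm, 'k::field) lin_moncat" +
  assumes unt: "Unt C = 0" and otm: "Otm C = (+)"
begin

fun valid :: "'m arrow \<Rightarrow> bool" where
  "valid Undef = False"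
| "valid (Arr m n f) = (f \<in> Mor C m n)"

definition ident :: "nat \<Rightarrow> 'm arrow" where
  "ident n = Arr n n (Idn C n)"

definition zeroA :: "nat \<Rightarrow> nat \<Rightarrow> 'm arrow" where
  "zeroA m n = Arr m n \<zero>\<^bsub>Hom C m n\<^esub>"

fun cmpA :: "'m arrow \<Rightarrow> 'm arrow \<Rightarrow> 'm arrow" (infixr \<open>\<diamondop>\<close> 70) where
  "Arr n' p g \<diamondop> Arr m n f =
    (if n = n' \<and> g \<in> Mor C n p \<and> f \<in> Mor C m n then Arr m p (Cmp C m n p g f) else Undef)"
| "_ \<diamondop> _ = Undef"

fun addA :: "'m arrow \<Rightarrow> 'm arrow \<Rightarrow> 'm arrow" (infixl \<open>\<boxplus>\<close> 65) where
  "Arr m n f \<boxplus> Arr m' n' g =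
    (if m = m' \<and> n = n' \<and> f \<in> Mor C m n \<and> g \<in> Mor C m n then Arr m n (f \<oplus>\<^bsub>Hom C m n\<^esub> g) else Undef)"
| "_ \<boxplus> _ = Undef"

fun smulA :: "'k \<Rightarrow> 'm arrow \<Rightarrow> 'm arrow" (infixr \<open>\<star>\<close> 75) where
  "c \<star> Arr m n f = (if f \<in> Mor C m n then Arr m n (c \<odot>\<^bsub>Hom C m n\<^esub> f) else Undef)"
| "c \<star> Undef = Undef"

text \<open>
  Whiskering, \<open>1\<^sub>a \<otimes> A \<otimes> 1\<^sub>b\<close>: a layer of a diagram with \<open>a\<close> strands to the left of \<open>A\<close> and \<open>b\<close> to its right.
\<close>

fun W :: "nat \<Rightarrow> 'm arrow \<Rightarrow> nat \<Rightarrow> 'm arrow" where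
  "W a (Arr m n f) b = (if f \<in> Mor C m n then Arr (a + m + b) (a + n + b)
     (Tns C (a + m) (a + n) b b (Tns C a a m n (Idn C a) f) (Idn C b)) else Undef)"
| "W a Undef b = Undef"

lemma tns_mor: "\<lbrakk>f \<in> Mor C m n; g \<in> Mor C m' n'\<rbrakk> \<Longrightarrow> Tns C m n m' n' f g \<in> Mor C (m + m') (n + n')"
  using tns_closed[of f m n g m' n'] by (simp add: otm)

lemmas closed = tns_mor cmp_closed idn_closed hom_add_closed hom_smult_closed hom_zero_closed

lemma valid_simps [simp]:
  "valid (ident n)" "valid (zeroA m n)"
  "valid (B \<diamondop> A) \<longleftrightarrow> valid A \<and> valid B \<and> cd A = dm B"
  "valid (A \<boxplus> B) \<longleftrightarrow> valid A \<and> valid B \<and> dm A = dm B \<and> cd A = cd B"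
  "valid (c \<star> A) \<longleftrightarrow> valid A" "valid (W a A b) \<longleftrightarrow> valid A"
  by (cases A; cases B; (auto simp: ident_def zeroA_def closed split: if_splits; fail))+

lemma dm_simps [simp]:
  "dm (ident n) = n" "dm (zeroA m n) = m"
  "valid (B \<diamondop> A) \<Longrightarrow> dm (B \<diamondop> A) = dm A"
  "valid (A \<boxplus> B) \<Longrightarrow> dm (A \<boxplus> B) = dm A"
  "valid A \<Longrightarrow> dm (c \<star> A) = dm A" "valid A \<Longrightarrow> dm (W a A b) = a + dm A + b"
  by (cases A; cases B; (auto simp: ident_def zeroA_def closed split: if_splits; fail))+

lemma cd_simps [simp]:
  "cd (ident n) = n" "cd (zeroA m n) = n"
  "valid (B \<diamondop> A) \<Longrightarrow> cd (B \<diamondop> A) = cd B"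
  "valid (A \<boxplus> B) \<Longrightarrow> cd (A \<boxplus> B) = cd A"
  "valid A \<Longrightarrow> cd (c \<star> A) = cd A" "valid A \<Longrightarrow> cd (W a A b) = a + cd A + b"
  by (cases A; cases B; (auto simp: ident_def zeroA_def closed split: if_splits; fail))+

subsection \<open>Category laws\<close>

lemma validE:
  assumes "valid A"
  obtains m n f where "A = Arr m n f" "f \<in> Mor C m n"
  using assms by (cases A) simp_all

lemma cmpA_Undef [simp]: "A \<diamondop> Undef = Undef" "Undef \<diamondop> A = Undef"
  by (cases A; simp)+

lemma cmpA_not_valid: "\<not> valid (B \<diamondop> A) \<Longrightarrow> B \<diamondop> A = Undef"
  by (cases A; cases B) (auto simp: closed)

lemma cmpA_assoc: "(D \<diamondop> B) \<diamondop> A = D \<diamondop> (B \<diamondop> A)"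
proof (cases "valid ((D \<diamondop> B) \<diamondop> A)")
  case True
  then have v: "valid A" "valid B" "valid D" and eq: "dm B = cd A" "dm D = cd B" by simp_all
  from v(1) obtain m n f where A: "A = Arr m n f" "f \<in> Mor C m n" by (rule validE)
  from v(2) obtain n' p g where B: "B = Arr n' p g" "g \<in> Mor C n' p" by (rule validE)
  from v(3) obtain p' q h where D: "D = Arr p' q h" "h \<in> Mor C p' q" by (rule validE)
  have "n' = n" "p' = p" using eq A B D by simp_all
  with A B D show ?thesis by (simp add: closed cmp_assoc)
next
  case False
  then have "\<not> valid (D \<diamondop> (B \<diamondop> A))" by auto
  from cmpA_not_valid[OF this] cmpA_not_valid[OF False] show ?thesis by simp
qed

lemma cmpA_ident_left: "\<lbrakk>valid A; cd A = n\<rbrakk> \<Longrightarrow> ident n \<diamondop> A = A"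
  by (cases A) (auto simp: ident_def closed cmp_idn_left)

lemma cmpA_ident_right: "\<lbrakk>valid A; dm A = n\<rbrakk> \<Longrightarrow> A \<diamondop> ident n = A"
  by (cases A) (auto simp: ident_def closed cmp_idn_right)

lemma W_ident: "W a (ident n) b = ident (a + n + b)"
  using tns_idn by (simp add: ident_def closed otm)

lemma W_cmpA: "W a (B \<diamondop> A) b = W a B b \<diamondop> W a A b"
proof (cases "valid (B \<diamondop> A)")
  case True
  then have v: "valid A" "valid B" and eq: "dm B = cd A" by simp_all
  from v(1) obtain m n f where A: "A = Arr m n f" "f \<in> Mor C m n" by (rule validE)
  from v(2) obtain n' p g where B': "B = Arr n' p g" "g \<in> Mor C n' p" by (rule validE)
  have "n' = n" using eq A B' by simp
  with B' have B: "B = Arr n p g" "g \<in> Mor C n p" by simp_all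
  have "Tns C a a m p (Idn C a) (Cmp C m n p g f) =
      Cmp C (a + m) (a + n) (a + p) (Tns C a a n p (Idn C a) g) (Tns C a a m n (Idn C a) f)"
    using interchange[of "Idn C a" a a "Idn C a" a f m n g p] A B by (simp add: closed otm cmp_idn_left)
  moreover have "Tns C (a + m) (a + p) b b (Cmp C (a + m) (a + n) (a + p) g' f') (Idn C b) =
      Cmp C (a + m + b) (a + n + b) (a + p + b) (Tns C (a + n) (a + p) b b g' (Idn C b))
        (Tns C (a + m) (a + n) b b f' (Idn C b))"
    if "f' \<in> Mor C (a + m) (a + n)" "g' \<in> Mor C (a + n) (a + p)" for f' g'
    using interchange[of f' "a + m" "a + n" g' "a + p" "Idn C b" b b "Idn C b" b] that
    by (simp add: closed otm cmp_idn_left)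
  ultimately show ?thesis using A B by (simp add: closed)
next
  case False
  then have "B \<diamondop> A = Undef" by (cases A; cases B) (auto simp: closed)
  moreover have "W a B b \<diamondop> W a A b = Undef" using False by (cases A; cases B) (auto simp: closed)
  ultimately show ?thesis by simp
qed

lemma tns_assoc': "\<lbrakk>f \<in> Mor C m n; f' \<in> Mor C m' n'; f'' \<in> Mor C m'' n''\<rbrakk> \<Longrightarrow>
    Tns C (m + m') (n + n') m'' n'' (Tns C m n m' n' f f') f'' =
    Tns C m n (m' + m'') (n' + n'') f (Tns C m' n' m'' n'' f' f'')"
  using tns_assoc[of f m n f' m' n' f'' m'' n''] by (simp add: otm)

lemma tns_idn': "Tns C m m n n (Idn C m) (Idn C n) = Idn C (m + n)"
  using tns_idn[of m n] by (simp add: otm)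

lemma W_W: "W a (W c A d) b = W (a + c) A (d + b)"
proof (cases A)
  case (Arr m n f)
  show ?thesis
  proof (cases "f \<in> Mor C m n")
    case True
    let ?cf = "Tns C c c m n (Idn C c) f" and ?acf = "Tns C (a + c) (a + c) m n (Idn C (a + c)) f"
    let ?cfd = "Tns C (c + m) (c + n) d d ?cf (Idn C d)"
    have cf: "?cf \<in> Mor C (c + m) (c + n)" using True by (intro tns_mor idn_closed)
    have cfd: "?cfd \<in> Mor C (c + m + d) (c + n + d)" by (rule tns_mor[OF cf idn_closed])
    have acf: "?acf \<in> Mor C (a + c + m) (a + c + n)" using True by (intro tns_mor idn_closed)
    have 1: "Tns C a a (c + m) (c + n) (Idn C a) ?cf = ?acf"
      using tns_assoc'[OF idn_closed[of a] idn_closed[of c] True] by (simp add: tns_idn')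
    have "Tns C a a (c + m + d) (c + n + d) (Idn C a) ?cfd =
        Tns C (a + (c + m)) (a + (c + n)) d d ?acf (Idn C d)"
      using tns_assoc'[OF idn_closed[of a] cf idn_closed[of d]] 1 by simp
    then have "Tns C (a + (c + m + d)) (a + (c + n + d)) b b
          (Tns C a a (c + m + d) (c + n + d) (Idn C a) ?cfd) (Idn C b) =
        Tns C (a + c + m) (a + c + n) (d + b) (d + b) ?acf (Idn C (d + b))"
      using tns_assoc'[OF acf idn_closed[of d] idn_closed[of b]] by (simp add: tns_idn' add.assoc)
    moreover have "W a (W c A d) b = Arr (a + (c + m + d) + b) (a + (c + n + d) + b)
        (Tns C (a + (c + m + d)) (a + (c + n + d)) b b
          (Tns C a a (c + m + d) (c + n + d) (Idn C a) ?cfd) (Idn C b))"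
      using Arr True cfd by simp
    ultimately show ?thesis using Arr True by (simp add: add.assoc)
  qed (use Arr in simp)
qed simp

lemma W_0: "valid A \<Longrightarrow> W 0 A 0 = A"
  using tns_unt_left tns_unt_right by (cases A) (auto simp: closed unt)

text \<open>
  By these formulas whiskering can replace the tensor product; that the two agree is the interchange law.
\<close>

lemma tns_via_W:
  assumes "f \<in> Mor C m n" "g \<in> Mor C m' n'"
  shows "Arr (m + m') (n + n') (Tns C m n m' n' f g) = W 0 (Arr m n f) n' \<diamondop> W m (Arr m' n' g) 0"
    and "Arr (m + m') (n + n') (Tns C m n m' n' f g) = W n (Arr m' n' g) 0 \<diamondop> W 0 (Arr m n f) m'"
proof -
  have W0: "W 0 (Arr m n f) b = Arr (m + b) (n + b) (Tns C m n b b f (Idn C b))" for b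
    using assms tns_unt_left by (simp add: unt)
  have W1: "W a (Arr m' n' g) 0 = Arr (a + m') (a + n') (Tns C a a m' n' (Idn C a) g)" for a
    using assms tns_unt_right[of "Tns C a a m' n' (Idn C a) g"] by (simp add: unt closed)
  show "Arr (m + m') (n + n') (Tns C m n m' n' f g) = W 0 (Arr m n f) n' \<diamondop> W m (Arr m' n' g) 0"
    using interchange[of "Idn C m" m m f n g m' n' "Idn C n'" n'] assms
    by (simp add: W0 W1 closed otm cmp_idn_left cmp_idn_right del: W.simps)
  show "Arr (m + m') (n + n') (Tns C m n m' n' f g) = W n (Arr m' n' g) 0 \<diamondop> W 0 (Arr m n f) m'"
    using interchange[of f m n "Idn C n" n "Idn C m'" m' m' g n'] assms
    by (simp add: W0 W1 closed otm cmp_idn_left cmp_idn_right del: W.simps)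
qed

lemma W_not_valid: "\<not> valid A \<Longrightarrow> W a A b = Undef"
  by (cases A) auto

lemma W_exchange_adjacent: "W 0 f (cd g) \<diamondop> W (dm f) g 0 = W (cd f) g 0 \<diamondop> W 0 f (dm g)"
proof (cases "valid f \<and> valid g")
  case True
  then have v: "valid f" "valid g" by simp_all
  from v(1) obtain m n f' where f: "f = Arr m n f'" "f' \<in> Mor C m n" by (rule validE)
  from v(2) obtain m' n' g' where g: "g = Arr m' n' g'" "g' \<in> Mor C m' n'" by (rule validE)
  from f g show ?thesis using tns_via_W[of f' m n g' m' n'] by simp
qed (auto simp: W_not_valid)

text \<open>
  The interchange law for layers; \<open>k\<close> counts the strands between the two pieces.
\<close>

lemma W_exchange_gap:
  "W a f (k + cd g + b) \<diamondop> W (a + dm f + k) g b = W (a + cd f + k) g b \<diamondop> W a f (k + dm g + b)"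
proof (cases "valid f \<and> valid g")
  case True
  have "W 0 f (cd (W k g 0)) \<diamondop> W (dm f) (W k g 0) 0 = W (cd f) (W k g 0) 0 \<diamondop> W 0 f (dm (W k g 0))"
    by (rule W_exchange_adjacent)
  then have "W a (W 0 f (cd (W k g 0)) \<diamondop> W (dm f) (W k g 0) 0) b =
      W a (W (cd f) (W k g 0) 0 \<diamondop> W 0 f (dm (W k g 0))) b" by simp
  then show ?thesis using True by (simp add: W_cmpA W_W add.assoc)
qed (auto simp: W_not_valid)

text \<open>
  The same law in a form where the positions can be computed by the simplifier: in a normal form the
  piece further to the left acts first. The last hypothesis excludes a piece without
  inputs applied after a piece without outputs at the same position, such as a cup after a cap: neither is to
  the left of the other, and \<open>\<eta>\<epsilon>\<close> is kept as it stands.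
\<close>

lemma W_exchange:
  assumes "a + dm f \<le> c" "cd g + d \<le> b" "0 < dm f + cd g \<or> a < c"
  shows "W a f b \<diamondop> W c g d = W (c - dm f + cd f) g d \<diamondop> W a f (b - cd g + dm g)"
proof (cases "valid f \<and> valid g \<and> c - (a + dm f) = b - (cd g + d)")
  case True
  define k where "k = c - (a + dm f)"
  have "c = a + dm f + k" "b = k + cd g + d" using assms True by (auto simp: k_def)
  moreover from this have "c - dm f + cd f = a + cd f + k" "b - cd g + dm g = k + dm g + d" by simp_all
  ultimately show ?thesis using W_exchange_gap[of a f k g d] by (simp only:)
next
  case False
  then have "\<not> valid (W a f b \<diamondop> W c g d)" "\<not> valid (W (c - dm f + cd f) g d \<diamondop> W a f (b - cd g + dm g))"
    using assms by auto
  from this[THEN cmpA_not_valid] show ?thesis by simp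
qed

lemma tail: "A = B \<Longrightarrow> A \<diamondop> r = B \<diamondop> r"
  by simp

lemma W_exchange_tail:
  assumes "a + dm f \<le> c" "cd g + d \<le> b" "0 < dm f + cd g \<or> a < c"
  shows "W a f b \<diamondop> W c g d \<diamondop> r = W (c - dm f + cd f) g d \<diamondop> W a f (b - cd g + dm g) \<diamondop> r"
  using W_exchange[OF assms, THEN tail, of r] by (simp only: cmpA_assoc)

subsection \<open>Linear structure\<close>

lemma addA_not_valid: "\<not> valid (A \<boxplus> B) \<Longrightarrow> A \<boxplus> B = Undef"
  by (cases A; cases B) (auto simp: closed)

lemma addA_assoc: "A \<boxplus> B \<boxplus> D = A \<boxplus> (B \<boxplus> D)"
proof (cases "valid (A \<boxplus> B \<boxplus> D)")
  case True
  then have v: "valid A" "valid B" "valid D"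
    and eq: "dm B = dm A" "dm D = dm A" "cd B = cd A" "cd D = cd A" by auto
  from v(1) obtain m n f where A: "A = Arr m n f" "f \<in> Mor C m n" by (rule validE)
  from v(2) obtain m' n' g where B: "B = Arr m' n' g" "g \<in> Mor C m' n'" by (rule validE)
  from v(3) obtain m'' n'' h where D: "D = Arr m'' n'' h" "h \<in> Mor C m'' n''" by (rule validE)
  have "m' = m" "n' = n" "m'' = m" "n'' = n" using eq A B D by simp_all
  with A B D show ?thesis by (simp add: closed hom_add_assoc)
next
  case False
  then have "\<not> valid (A \<boxplus> (B \<boxplus> D))" by auto
  from addA_not_valid[OF this] addA_not_valid[OF False] show ?thesis by simp
qed

lemma addA_commute: "A \<boxplus> B = B \<boxplus> A"
  by (cases A; cases B; auto simp: closed hom_add_comm)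

lemma addA_left_commute: "A \<boxplus> (B \<boxplus> D) = B \<boxplus> (A \<boxplus> D)"
  by (simp only: addA_assoc[symmetric] addA_commute[of A B])

lemma addA_zeroA: "\<lbrakk>valid A; dm A = m; cd A = n\<rbrakk> \<Longrightarrow> A \<boxplus> zeroA m n = A"
  using hom_add_comm[of _ m n "\<zero>\<^bsub>Hom C m n\<^esub>"]
  by (cases A) (auto simp: zeroA_def hom_zero_closed hom_add_zero_left)

lemma smulA_add: "c \<star> (A \<boxplus> B) = c \<star> A \<boxplus> c \<star> B"
  by (cases A; cases B; auto simp: closed hom_smult_add)

lemma add_smulA: "(c + d) \<star> A = c \<star> A \<boxplus> d \<star> A"
  by (cases A) (auto simp: closed hom_add_smult)

lemma smulA_smulA: "c \<star> d \<star> A = (c * d) \<star> A"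
  by (cases A) (auto simp: closed hom_smult_smult)

lemma smulA_one: "valid A \<Longrightarrow> 1 \<star> A = A"
  by (cases A) (auto simp: hom_smult_one)

lemma smulA_0: "valid A \<Longrightarrow> 0 \<star> A = zeroA (dm A) (cd A)"
  by (cases A) (auto simp: zeroA_def hom_smult_zero)

lemma smulA_zeroA: "c \<star> zeroA m n = zeroA m n"
  by (auto simp: zeroA_def hom_zero_closed hom_smult_zero_right)

lemma cmpA_add_left: "(B \<boxplus> D) \<diamondop> A = B \<diamondop> A \<boxplus> D \<diamondop> A"
proof (cases "valid ((B \<boxplus> D) \<diamondop> A)")
  case True
  then have v: "valid A" "valid B" "valid D" and eq: "dm B = cd A" "dm D = dm B" "cd D = cd B" by simp_all
  from v(1) obtain m n f where A: "A = Arr m n f" "f \<in> Mor C m n" by (rule validE)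
  from v(2) obtain n' p g where B: "B = Arr n' p g" "g \<in> Mor C n' p" by (rule validE)
  from v(3) obtain n'' p' h where D: "D = Arr n'' p' h" "h \<in> Mor C n'' p'" by (rule validE)
  have "n' = n" "n'' = n" "p' = p" using eq A B D by simp_all
  with A B D show ?thesis by (simp add: closed cmp_add_left)
next
  case False
  then have "\<not> valid (B \<diamondop> A \<boxplus> D \<diamondop> A)" by auto
  from addA_not_valid[OF this] cmpA_not_valid[OF False] show ?thesis by simp
qed

lemma cmpA_add_right: "D \<diamondop> (A \<boxplus> B) = D \<diamondop> A \<boxplus> D \<diamondop> B"
proof (cases "valid (D \<diamondop> (A \<boxplus> B))")
  case True
  then have v: "valid A" "valid B" "valid D" and eq: "dm B = dm A" "dm D = cd A" "cd B = cd A" by auto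
  from v(1) obtain m n f where A: "A = Arr m n f" "f \<in> Mor C m n" by (rule validE)
  from v(2) obtain m' n' g where B: "B = Arr m' n' g" "g \<in> Mor C m' n'" by (rule validE)
  from v(3) obtain n'' p h where D: "D = Arr n'' p h" "h \<in> Mor C n'' p" by (rule validE)
  have "m' = m" "n' = n" "n'' = n" using eq A B D by simp_all
  with A B D show ?thesis by (simp add: closed cmp_add_right)
next
  case False
  then have "\<not> valid (D \<diamondop> A \<boxplus> D \<diamondop> B)" by auto
  from addA_not_valid[OF this] cmpA_not_valid[OF False] show ?thesis by simp
qed

lemma cmpA_smul_left: "(c \<star> B) \<diamondop> A = c \<star> (B \<diamondop> A)"
  by (cases A; cases B; auto simp: closed cmp_smult_left)

lemma cmpA_smul_right: "B \<diamondop> (c \<star> A) = c \<star> (B \<diamondop> A)"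
  by (cases A; cases B; auto simp: closed cmp_smult_right)

lemma W_add: "W a (A \<boxplus> B) b = W a A b \<boxplus> W a B b"
proof (cases "valid (A \<boxplus> B)")
  case True
  then have v: "valid A" "valid B" and eq: "dm B = dm A" "cd B = cd A" by auto
  from v(1) obtain m n f where A: "A = Arr m n f" "f \<in> Mor C m n" by (rule validE)
  from v(2) obtain m' n' g where B: "B = Arr m' n' g" "g \<in> Mor C m' n'" by (rule validE)
  have "m' = m" "n' = n" using eq A B by simp_all
  with A B show ?thesis
    by (simp add: closed tns_add_left[unfolded otm] tns_add_right[unfolded otm])
next
  case False
  then have "\<not> valid (W a A b \<boxplus> W a B b)" by auto
  from addA_not_valid[OF this] addA_not_valid[OF False] show ?thesis by simp
qed

lemma W_smul: "W a (c \<star> A) b = c \<star> W a A b"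
  by (cases A; auto simp: closed tns_smult_left[unfolded otm] tns_smult_right[unfolded otm])

lemma cmpA_zeroA_right: "\<lbrakk>valid B; dm B = n\<rbrakk> \<Longrightarrow> B \<diamondop> zeroA m n = zeroA m (cd B)"
  using cmpA_smul_right[of B 0 "zeroA m n"] by (simp add: smulA_0)

lemma cmpA_zeroA_left: "\<lbrakk>valid A; cd A = n\<rbrakk> \<Longrightarrow> zeroA n p \<diamondop> A = zeroA (dm A) p"
  using cmpA_smul_left[of 0 "zeroA n p" A] by (simp add: smulA_0)

lemma W_zeroA: "W a (zeroA m n) b = zeroA (a + m + b) (a + n + b)"
  using W_smul[of a 0 "zeroA m n" b] by (simp add: smulA_0)

lemma smulA_eq_zeroA:
  assumes "c \<star> A = zeroA m n" "c \<noteq> 0" "valid A"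
  shows "A = zeroA m n"
proof -
  have "inverse c \<star> c \<star> A = A" using assms(2,3) by (simp add: smulA_smulA smulA_one)
  then show ?thesis using assms(1) by (simp add: smulA_zeroA)
qed

lemma add_neg: "valid A \<Longrightarrow> A \<boxplus> (-1) \<star> A = zeroA (dm A) (cd A)"
  using add_smulA[of 1 "-1" A] by (simp add: smulA_one smulA_0)

lemma smulA_inj:
  assumes "c \<star> A = d \<star> A" "valid A" "A \<noteq> zeroA (dm A) (cd A)"
  shows "c = d"
proof (rule ccontr)
  assume "c \<noteq> d"
  have "(c - d) \<star> A = c \<star> A \<boxplus> (-1) \<star> d \<star> A"
    using add_smulA[of c "-d" A] by (simp add: smulA_smulA)
  also have "\<dots> = zeroA (dm A) (cd A)" using assms(1,2) add_neg[of "d \<star> A"] by simp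
  finally have "A = zeroA (dm A) (cd A)"
    using \<open>c \<noteq> d\<close> assms(2) by (intro smulA_eq_zeroA[of "c - d" A]) simp_all
  then show False using assms(3) by simp
qed

end

section \<open>Diagrams in the generators\<close>

text \<open>
  The generators \<open>\<mu>\<close>, \<open>\<tau>\<close>, \<open>\<eta>\<close>, \<open>\<epsilon>\<close> stand for \<open>m\<close>, \<open>s\<close>, the cup and the cap, as arrows of any category satisfying
  the relations; tensor products with identities are written as whiskerings.
\<close>

locale diagrams = tensor_powers C
  for C :: "(nat, 'm, 'k::field) lin_moncat" +
  fixes \<mu> \<tau> \<eta> \<epsilon> :: "'m arrow" and \<delta> \<alpha> :: 'k
  assumes valid_gen: "valid \<mu>" "valid \<tau>" "valid \<eta>" "valid \<epsilon>"
    and dm_gen: "dm \<mu> = 2" "dm \<tau> = 2" "dm \<eta> = 0" "dm \<epsilon> = 2"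
    and cd_gen: "cd \<mu> = 1" "cd \<tau> = 2" "cd \<eta> = 2" "cd \<epsilon> = 0"
    and zigzag1: "W 0 \<epsilon> 1 \<diamondop> W 1 \<eta> 0 = ident 1"
    and zigzag2: "W 1 \<epsilon> 0 \<diamondop> W 0 \<eta> 1 = ident 1"
    and sigma_sym: "W 1 \<mu> 0 \<diamondop> W 0 \<eta> 1 = W 0 \<mu> 1 \<diamondop> W 1 \<eta> 0"
    and cap_slide: "W 1 \<epsilon> 0 \<diamondop> W 0 \<tau> 1 = W 0 \<epsilon> 1 \<diamondop> W 1 \<tau> 0"
    and involution: "\<tau> \<diamondop> \<tau> = ident 2"
    and braid_rel: "W 0 \<tau> 1 \<diamondop> W 1 \<tau> 0 \<diamondop> W 0 \<tau> 1 = W 1 \<tau> 0 \<diamondop> W 0 \<tau> 1 \<diamondop> W 1 \<tau> 0"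
    and mult_slide: "W 1 \<mu> 0 \<diamondop> W 0 \<tau> 1 \<diamondop> W 1 \<tau> 0 = \<tau> \<diamondop> W 0 \<mu> 1"
    and sigma_slide: "W 1 \<tau> 0 \<diamondop> W 0 \<tau> 1 \<diamondop> W 1 (W 1 \<mu> 0 \<diamondop> W 0 \<eta> 1) 0 =
      W 0 (W 1 \<mu> 0 \<diamondop> W 0 \<eta> 1) 1 \<diamondop> \<tau>"
    and cap_sym: "\<epsilon> \<diamondop> \<tau> = \<epsilon>"
    and mult_skew: "\<mu> \<diamondop> \<tau> = (-1) \<star> \<mu>"
    and bigon: "\<mu> \<diamondop> W 1 \<mu> 0 \<diamondop> W 0 \<eta> 1 = \<alpha> \<star> ident 1"
    and loop: "\<epsilon> \<diamondop> \<eta> = \<delta> \<star> ident 0"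
begin

definition \<sigma> :: "'m arrow" where
  "\<sigma> = W 1 \<mu> 0 \<diamondop> W 0 \<eta> 1"

lemma gen_simps [simp]:
  "valid \<mu>" "valid \<tau>" "valid \<eta>" "valid \<epsilon>"
  "dm \<mu> = Suc (Suc 0)" "dm \<tau> = Suc (Suc 0)" "dm \<eta> = 0" "dm \<epsilon> = Suc (Suc 0)"
  "cd \<mu> = Suc 0" "cd \<tau> = Suc (Suc 0)" "cd \<eta> = Suc (Suc 0)" "cd \<epsilon> = 0"
  using valid_gen dm_gen cd_gen by simp_all

lemma sigma_simps [simp]: "valid \<sigma>" "dm \<sigma> = Suc 0" "cd \<sigma> = Suc (Suc 0)"
  by (simp_all add: \<sigma>_def)

lemmas layers = cmpA_assoc W_cmpA W_W W_ident cmpA_ident_left cmpA_ident_right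

lemmas exchange = W_exchange W_exchange_tail

text \<open>
  Relations hold inside larger diagrams. A relation between two layers can be whiskered, and
  \<open>tail2\<close> applies it in front of further layers of a composite associated to the right.
  The instances below use \<open>Suc\<close> so that they match positions in unary form.
\<close>

lemma whiskered2:
  assumes "W c A d \<diamondop> W c' A' d' = B"
  shows "W (a + c) A (d + b) \<diamondop> W (a + c') A' (d' + b) = W a B b"
  using arg_cong[OF assms, of "\<lambda>x. W a x b"] by (simp only: layers)

lemma tail2: "A \<diamondop> B = D \<Longrightarrow> A \<diamondop> B \<diamondop> r = D \<diamondop> r"
  by (simp add: cmpA_assoc[symmetric])

lemma zigzag1_W: "W a \<epsilon> (Suc b) \<diamondop> W (Suc a) \<eta> b = ident (Suc (a + b))"
  using whiskered2[OF zigzag1, of a b] by (simp add: W_ident)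

lemma zigzag2_W: "W (Suc a) \<epsilon> b \<diamondop> W a \<eta> (Suc b) = ident (Suc (a + b))"
  using whiskered2[OF zigzag2, of a b] by (simp add: W_ident)

lemma sigma_W: "W (Suc a) \<mu> b \<diamondop> W a \<eta> (Suc b) = W a \<sigma> b"
  using whiskered2[OF \<sigma>_def[symmetric], of a b] by simp

lemma sigma_W': "W a \<mu> (Suc b) \<diamondop> W (Suc a) \<eta> b = W a \<sigma> b"
  using whiskered2[OF sigma_sym[symmetric], folded \<sigma>_def, of a b] by simp

lemma cap_slide_W: "W (Suc a) \<epsilon> b \<diamondop> W a \<tau> (Suc b) = W a \<epsilon> (Suc b) \<diamondop> W (Suc a) \<tau> b"
  using whiskered2[OF cap_slide, of a b] by (simp add: layers)

lemma involution_W: "W a \<tau> b \<diamondop> W a \<tau> b = ident (Suc (Suc (a + b)))"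
  using arg_cong[OF involution, of "\<lambda>x. W a x b"] by (simp add: layers)

lemma cap_sym_W: "W a \<epsilon> b \<diamondop> W a \<tau> b = W a \<epsilon> b"
  using arg_cong[OF cap_sym, of "\<lambda>x. W a x b"] by (simp add: layers)

lemma mult_skew_W: "W a \<mu> b \<diamondop> W a \<tau> b = (-1) \<star> W a \<mu> b"
  using arg_cong[OF mult_skew, of "\<lambda>x. W a x b"] by (simp add: layers W_smul)

lemmas straighten = zigzag1_W zigzag2_W zigzag1_W[THEN tail2] zigzag2_W[THEN tail2]
lemmas diag = layers exchange straighten

lemma W_00: "W 0 \<tau> 0 = \<tau>" "W 0 \<mu> 0 = \<mu>" "W 0 \<epsilon> 0 = \<epsilon>" "W 0 \<eta> 0 = \<eta>" "W 0 \<sigma> 0 = \<sigma>"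
  by (simp_all add: W_0)

text \<open>
  The crossing is invariant under a quarter turn. The slide of a strand over the cap
  moves the crossing to the other leg of the cap, and the zigzag straightens what remains.
\<close>

lemma cross_rotate_left:
  "W a \<tau> b = W (Suc (Suc a)) \<epsilon> b \<diamondop> W (Suc a) \<tau> (Suc b) \<diamondop> W a \<eta> (Suc (Suc b))"
proof -
  have "W a \<tau> b = W (Suc a) \<epsilon> (Suc b) \<diamondop> W a \<eta> (Suc (Suc b)) \<diamondop> W a \<tau> b"
    by (simp add: straighten layers)
  also have "\<dots> = W (Suc a) \<epsilon> (Suc b) \<diamondop> W (Suc (Suc a)) \<tau> b \<diamondop> W a \<eta> (Suc (Suc b))"
    by (simp add: exchange)
  also have "\<dots> = W (Suc (Suc a)) \<epsilon> b \<diamondop> W (Suc a) \<tau> (Suc b) \<diamondop> W a \<eta> (Suc (Suc b))"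
    by (simp add: cap_slide_W[THEN tail2] cmpA_assoc)
  finally show ?thesis .
qed

lemma cross_rotate_right:
  "W a \<epsilon> (Suc (Suc b)) \<diamondop> W (Suc a) \<tau> (Suc b) \<diamondop> W (Suc (Suc a)) \<eta> b = W a \<tau> b"
proof -
  have "W a \<epsilon> (Suc (Suc b)) \<diamondop> W (Suc a) \<tau> (Suc b) \<diamondop> W (Suc (Suc a)) \<eta> b =
      W (Suc a) \<epsilon> (Suc b) \<diamondop> W a \<tau> (Suc (Suc b)) \<diamondop> W (Suc (Suc a)) \<eta> b"
    by (simp add: cap_slide_W[THEN tail2] cmpA_assoc)
  also have "\<dots> = W (Suc a) \<epsilon> (Suc b) \<diamondop> W (Suc (Suc a)) \<eta> b \<diamondop> W a \<tau> b"
    by (simp add: exchange)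
  also have "\<dots> = W a \<tau> b"
    by (simp add: straighten layers)
  finally show ?thesis .
qed

text \<open>
  The slide over the cup is the slide over the cap turned upside down: one strand of the crossing is
  bent by \<open>cross_rotate_left\<close>, and the cup cancels against the new cap.
\<close>

lemma cup_slide_W: "W a \<tau> (Suc b) \<diamondop> W (Suc a) \<eta> b = W (Suc a) \<tau> b \<diamondop> W a \<eta> (Suc b)"
  by (subst cross_rotate_left) (simp add: diag)

text \<open>
  If a zigzag is applied after the curl and the layers are moved past each other, the crossing appears as
  a quarter-turned crossing followed by the cap of the zigzag. The quarter turn fixes the crossing, and
  the symmetric cap absorbs it.
\<close>

lemma curl: "W (Suc 0) \<epsilon> 0 \<diamondop> W 0 \<tau> (Suc 0) \<diamondop> W (Suc 0) \<eta> 0 = ident (Suc 0)"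
proof -
  let ?curl = "W (Suc 0) \<epsilon> 0 \<diamondop> W 0 \<tau> (Suc 0) \<diamondop> W (Suc 0) \<eta> 0"
  have "?curl = W (Suc 0) \<epsilon> 0 \<diamondop> W 0 \<eta> (Suc 0) \<diamondop> ?curl"
    by (simp add: straighten layers)
  also have "\<dots> = W 1 \<epsilon> 0 \<diamondop> (W 1 \<epsilon> 2 \<diamondop> W 2 \<tau> 1 \<diamondop> W 3 \<eta> 0) \<diamondop> W 0 \<eta> 1"
    by (simp add: layers exchange eval_nat_numeral)
  also have "W 1 \<epsilon> 2 \<diamondop> W 2 \<tau> 1 \<diamondop> W 3 \<eta> 0 = W 1 \<tau> 0"
    using cross_rotate_right[of 1 0] by (simp add: eval_nat_numeral)
  also have "W 1 \<epsilon> 0 \<diamondop> W 1 \<tau> 0 \<diamondop> W 0 \<eta> 1 = ident (Suc 0)"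
    by (simp add: cap_sym_W[THEN tail2] straighten)
  finally show ?thesis .
qed

text \<open>
  Bending one leg of the cup turns its crossing into a curl.
\<close>

lemma cup_sym: "\<tau> \<diamondop> \<eta> = \<eta>"
proof -
  have "W 0 \<tau> 0 \<diamondop> W 0 \<eta> 0 = W 1 \<epsilon> 1 \<diamondop> W 0 \<eta> 2 \<diamondop> W 0 \<tau> 0 \<diamondop> W 0 \<eta> 0"
    by (simp add: straighten layers eval_nat_numeral)
  also have "\<dots> = W 1 (W 0 \<epsilon> 1 \<diamondop> W 1 \<tau> 0 \<diamondop> W 1 \<eta> 0) 0 \<diamondop> W 0 \<eta> 0"
    by (simp add: layers exchange eval_nat_numeral)
  also have "W 0 \<epsilon> 1 \<diamondop> W 1 \<tau> 0 \<diamondop> W 1 \<eta> 0 = ident 1"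
    using curl by (simp add: cap_slide_W[THEN tail2] cmpA_assoc)
  finally show ?thesis by (simp add: layers W_00)
qed

text \<open>A cap reverses a leg of the trivalent vertex, in the same way as the definition of \<open>\<sigma>\<close> does by a cup.\<close>

lemma cap_sigma_left: "W a \<epsilon> (Suc b) \<diamondop> W (Suc a) \<sigma> b = W a \<mu> b"
  by (simp add: sigma_W[symmetric] diag)

lemma cap_sigma_right: "W (Suc a) \<epsilon> b \<diamondop> W a \<sigma> (Suc b) = W a \<mu> b"
proof -
  have "W a \<mu> b = W a \<mu> b \<diamondop> W (Suc (Suc a)) \<epsilon> b \<diamondop> W (Suc a) \<eta> (Suc b)"
    by (simp add: straighten layers)
  also have "\<dots> = W (Suc a) \<epsilon> b \<diamondop> W a \<mu> (Suc (Suc b)) \<diamondop> W (Suc a) \<eta> (Suc b)"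
    by (simp add: exchange)
  finally show ?thesis by (simp add: sigma_W')
qed

subsection \<open>Endomorphisms of \<open>X \<otimes> X\<close>\<close>

text \<open>
  The three trivalent trees with two inputs and two outputs: the vertical, the horizontal and the crossed one;
  and the cap followed by the cup.
\<close>

definition Kd where "Kd = \<sigma> \<diamondop> \<mu>"
definition Hd where "Hd = W 0 \<mu> 1 \<diamondop> W 1 \<sigma> 0"
definition Dd where "Dd = W 0 \<mu> 1 \<diamondop> W 1 \<tau> 0 \<diamondop> W 0 \<sigma> 1"
definition Ud where "Ud = \<eta> \<diamondop> \<epsilon>"

text \<open>
  Three ways of bending strands of an endomorphism of \<open>X \<otimes> X\<close>: a quarter turn; the partial trace, which
  closes the second strand on the right; and the morphism \<open>X\<^sup>\<otimes>\<^sup>3 \<rightarrow> X\<close> obtained by turning the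
  second output into a third input.
\<close>

definition rot where "rot f = W 0 \<epsilon> 2 \<diamondop> W 1 f 1 \<diamondop> W 2 \<eta> 0"
definition ptr where "ptr f = W 1 \<epsilon> 0 \<diamondop> W 0 f 1 \<diamondop> W 1 \<eta> 0"
definition bend where "bend f = W 1 \<epsilon> 0 \<diamondop> W 0 f 1"

lemma endo_simps [simp]:
  "valid Kd" "dm Kd = 2" "cd Kd = 2" "valid Hd" "dm Hd = 2" "cd Hd = 2"
  "valid Dd" "dm Dd = 2" "cd Dd = 2" "valid Ud" "dm Ud = 2" "cd Ud = 2"
  by (simp_all add: Kd_def Hd_def Dd_def Ud_def eval_nat_numeral)

lemma rot_ident: "rot (ident 2) = Ud"
proof -
  have "rot (ident 2) = W 0 \<epsilon> 2 \<diamondop> W 2 \<eta> 0"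
    by (simp add: rot_def layers eval_nat_numeral)
  also have "\<dots> = Ud" by (simp add: exchange Ud_def W_00 eval_nat_numeral)
  finally show ?thesis .
qed

lemma rot_cross: "rot \<tau> = \<tau>"
  using cross_rotate_right[of 0 0] by (simp add: rot_def W_00 eval_nat_numeral)

lemma rot_Ud: "rot Ud = ident 2"
proof -
  have "rot Ud = W 0 \<epsilon> 2 \<diamondop> W 1 \<eta> 1 \<diamondop> W 1 \<epsilon> 1 \<diamondop> W 2 \<eta> 0"
    by (simp add: rot_def Ud_def layers)
  then show ?thesis by (simp add: straighten layers eval_nat_numeral)
qed

text \<open>
  The cap and the cup of the quarter turn each reverse one leg of a trivalent vertex, which turns the
  vertical tree \<open>K\<close> into the horizontal tree \<open>H\<close>.
\<close>

lemma rot_Kd: "rot Kd = Hd"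
proof -
  have "rot Kd = W 0 \<epsilon> 2 \<diamondop> W 1 \<sigma> 1 \<diamondop> W 1 \<mu> 1 \<diamondop> W 2 \<eta> 0"
    by (simp add: rot_def Kd_def layers)
  then show ?thesis
    by (simp add: Hd_def cap_sigma_left[THEN tail2] sigma_W' cmpA_assoc eval_nat_numeral)
qed

text \<open>
  Sliding \<open>\<sigma>\<close> through the crossing produces two crossings. The one that feeds \<open>\<mu>\<close> is absorbed by skew
  symmetry at the cost of a sign, the other one is the crossing in \<open>D\<close>.
\<close>

lemma Hd_cross: "Hd \<diamondop> \<tau> = (-1) \<star> Dd"
proof -
  have slide: "W 1 \<tau> 0 \<diamondop> W 0 \<tau> 1 \<diamondop> W 1 \<sigma> 0 = W 0 \<sigma> 1 \<diamondop> \<tau>"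
    using sigma_slide by (simp add: \<sigma>_def)
  have "W 1 \<sigma> 0 \<diamondop> \<tau> = W 0 \<tau> 1 \<diamondop> W 1 \<tau> 0 \<diamondop> (W 1 \<tau> 0 \<diamondop> W 0 \<tau> 1 \<diamondop> W 1 \<sigma> 0) \<diamondop> \<tau>"
    by (simp add: cmpA_assoc involution_W[THEN tail2] layers)
  also have "\<dots> = W 0 \<tau> 1 \<diamondop> W 1 \<tau> 0 \<diamondop> W 0 \<sigma> 1"
    by (simp only: slide) (simp add: cmpA_assoc involution layers eval_nat_numeral)
  finally have "Hd \<diamondop> \<tau> = (W 0 \<mu> 1 \<diamondop> W 0 \<tau> 1) \<diamondop> W 1 \<tau> 0 \<diamondop> W 0 \<sigma> 1"
    by (simp add: Hd_def cmpA_assoc)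
  then show ?thesis by (simp add: mult_skew_W cmpA_smul_left Dd_def)
qed

lemma Kd_cross: "Kd \<diamondop> \<tau> = (-1) \<star> Kd"
  by (simp add: Kd_def cmpA_assoc mult_skew cmpA_smul_right)

lemma Ud_cross: "Ud \<diamondop> \<tau> = Ud"
  by (simp add: Ud_def cmpA_assoc cap_sym)

lemma mult_sigma: "\<mu> \<diamondop> \<sigma> = \<alpha> \<star> ident 1"
  using bigon by (simp add: \<sigma>_def)

lemma ptr_Kd: "ptr Kd = \<alpha> \<star> ident 1"
proof -
  have "ptr Kd = W 1 \<epsilon> 0 \<diamondop> W 0 \<sigma> 1 \<diamondop> W 0 \<mu> 1 \<diamondop> W 1 \<eta> 0"
    by (simp add: ptr_def Kd_def layers)
  also have "\<dots> = \<mu> \<diamondop> \<sigma>"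
    by (simp add: cap_sigma_right[THEN tail2] sigma_W' cmpA_assoc W_00)
  finally show ?thesis by (simp add: mult_sigma)
qed

lemma ptr_ident: "ptr (ident 2) = \<delta> \<star> ident 1"
  using arg_cong[OF loop, of "\<lambda>x. W 1 x 0"]
  by (simp add: ptr_def layers W_smul eval_nat_numeral)

lemma ptr_cross: "ptr \<tau> = ident 1"
  using curl by (simp add: ptr_def)

lemma bend_Kd: "bend Kd = \<mu> \<diamondop> W 0 \<mu> 1"
  by (simp add: bend_def Kd_def W_cmpA cap_sigma_right[THEN tail2] W_00)

lemma cap_mult: "W 1 \<epsilon> 0 \<diamondop> W 0 \<mu> 2 = \<mu> \<diamondop> W 2 \<epsilon> 0"
proof -
  have "W 0 \<mu> 0 \<diamondop> W 2 \<epsilon> 0 = W 1 \<epsilon> 0 \<diamondop> W 0 \<mu> 2"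
    by (simp add: exchange eval_nat_numeral)
  then show ?thesis by (simp add: W_00)
qed

lemma bend_Hd: "bend Hd = \<mu> \<diamondop> W 1 \<mu> 0"
proof -
  have "bend Hd = (W 1 \<epsilon> 0 \<diamondop> W 0 \<mu> 2) \<diamondop> W 1 \<sigma> 1"
    by (simp add: bend_def Hd_def layers eval_nat_numeral)
  also have "\<dots> = \<mu> \<diamondop> W 2 \<epsilon> 0 \<diamondop> W 1 \<sigma> 1" by (simp only: cap_mult[THEN tail2] cmpA_assoc)
  also have "\<dots> = \<mu> \<diamondop> W 1 \<mu> 0"
    by (simp add: cap_sigma_right eval_nat_numeral)
  finally show ?thesis .
qed

text \<open>
  The last of the three terms of the Jacobi identity: the cap slides over the crossing and then
  reverses the leg of \<open>\<sigma>\<close>.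
\<close>

lemma bend_Dd: "bend Dd = \<mu> \<diamondop> W 0 \<mu> 1 \<diamondop> W 1 \<tau> 0"
proof -
  have "bend Dd = (W 1 \<epsilon> 0 \<diamondop> W 0 \<mu> 2) \<diamondop> W 1 \<tau> 1 \<diamondop> W 0 \<sigma> 2"
    by (simp add: bend_def Dd_def layers eval_nat_numeral)
  also have "\<dots> = \<mu> \<diamondop> W 2 \<epsilon> 0 \<diamondop> W 1 \<tau> 1 \<diamondop> W 0 \<sigma> 2" by (simp only: cap_mult[THEN tail2] cmpA_assoc)
  also have "\<dots> = \<mu> \<diamondop> W 1 \<epsilon> 1 \<diamondop> W 2 \<tau> 0 \<diamondop> W 0 \<sigma> 2"
    by (simp add: cap_slide_W[THEN tail2] cmpA_assoc eval_nat_numeral)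
  also have "W 2 \<tau> 0 \<diamondop> W 0 \<sigma> 2 = W 0 \<sigma> 2 \<diamondop> W 1 \<tau> 0"
    by (simp add: exchange eval_nat_numeral)
  also have "\<mu> \<diamondop> W 1 \<epsilon> 1 \<diamondop> W 0 \<sigma> 2 \<diamondop> W 1 \<tau> 0 = \<mu> \<diamondop> W 0 \<mu> 1 \<diamondop> W 1 \<tau> 0"
    by (simp add: cap_sigma_right[THEN tail2] eval_nat_numeral)
  finally show ?thesis .
qed

end

section \<open>Bases of a three-dimensional space\<close>

lemma lincomb_triple:
  fixes V :: "('k::field, 'v) module"
  assumes V: "vectorspace class_ring V" and c: "u \<in> carrier V" "v \<in> carrier V" "w \<in> carrier V"
    and d: "u \<noteq> v" "u \<noteq> w" "v \<noteq> w"
  shows "module.lincomb V a {u, v, w} = a u \<odot>\<^bsub>V\<^esub> u \<oplus>\<^bsub>V\<^esub> (a v \<odot>\<^bsub>V\<^esub> v \<oplus>\<^bsub>V\<^esub> a w \<odot>\<^bsub>V\<^esub> w)"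
proof -
  interpret vectorspace class_ring V by (rule V)
  have cl: "b \<odot>\<^bsub>V\<^esub> x \<in> carrier V" if "x \<in> carrier V" for b x
    using that smult_closed[of b x] by simp
  show ?thesis
    unfolding lincomb_def using c d by (simp add: cl Pi_def)
qed

lemma independent_triple_spans:
  fixes V :: "('k::field, 'v) module"
  assumes V: "vectorspace class_ring V"
    and fd: "vectorspace.fin_dim class_ring V" and dim: "vectorspace.dim class_ring V = 3"
    and c: "u \<in> carrier V" "v \<in> carrier V" "w \<in> carrier V"
    and indep: "\<And>x y z. x \<odot>\<^bsub>V\<^esub> u \<oplus>\<^bsub>V\<^esub> (y \<odot>\<^bsub>V\<^esub> v \<oplus>\<^bsub>V\<^esub> z \<odot>\<^bsub>V\<^esub> w) = \<zero>\<^bsub>V\<^esub> \<Longrightarrow> x = 0 \<and> y = 0 \<and> z = 0"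
    and t: "t \<in> carrier V"
  shows "\<exists>x y z. t = x \<odot>\<^bsub>V\<^esub> u \<oplus>\<^bsub>V\<^esub> (y \<odot>\<^bsub>V\<^esub> v \<oplus>\<^bsub>V\<^esub> z \<odot>\<^bsub>V\<^esub> w)"
proof -
  interpret vectorspace class_ring V by (rule V)
  have cl: "b \<odot>\<^bsub>V\<^esub> x \<in> carrier V" if "x \<in> carrier V" for b x
    using that smult_closed[of b x] by simp
  have one: "1 \<odot>\<^bsub>V\<^esub> x = x" if "x \<in> carrier V" for x using that smult_one[of x] by simp
  have null: "0 \<odot>\<^bsub>V\<^esub> x = \<zero>\<^bsub>V\<^esub>" if "x \<in> carrier V" for x using that smult_l_null[of x] by simp
  have neg: "(-1) \<odot>\<^bsub>V\<^esub> x = \<ominus>\<^bsub>V\<^esub> x" if "x \<in> carrier V" for x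
    using that smult_l_minus[of 1 x] one by (simp add: class_ring_simps)
  have d: "u \<noteq> v" "u \<noteq> w" "v \<noteq> w"
    using indep[of 1 "-1" 0] indep[of 1 0 "-1"] indep[of 0 1 "-1"] c
    by (auto simp: one null neg M.r_neg)
  let ?S = "{u, v, w}"
  have S: "finite ?S" "?S \<subseteq> carrier V" "card ?S = 3" using c d by auto
  have "lin_indpt ?S"
  proof
    assume "lin_dep ?S"
    then obtain a x where "lincomb a ?S = \<zero>\<^bsub>V\<^esub>" "x \<in> ?S" "a x \<noteq> 0"
      using finite_lin_dep[OF S(1) _ S(2)] by auto
    then show False using indep[of "a u" "a v" "a w"] lincomb_triple[OF V c d, of a] by auto
  qed
  then have "basis ?S" using fd S dim by (intro dim_li_is_basis) auto
  then have "t \<in> span ?S" using t by (simp add: basis_def)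
  then obtain a where "lincomb a ?S = t" using finite_in_span[OF S(1,2)] by blast
  then show ?thesis using lincomb_triple[OF V c d, of a] by metis
qed

lemma dim_le_1_of_trivial:
  assumes V: "vectorspace K V" and triv: "carrier V \<subseteq> {\<zero>\<^bsub>V\<^esub>}"
  shows "vectorspace.dim K V \<le> 1"
proof -
  interpret vectorspace K V by (rule V)
  have "carrier V = {\<zero>\<^bsub>V\<^esub>}" using triv by auto
  moreover have "\<zero>\<^bsub>V\<^esub> \<in> span {\<zero>\<^bsub>V\<^esub>}" by (intro in_own_span[THEN subsetD]) auto
  moreover have "span {\<zero>\<^bsub>V\<^esub>} \<subseteq> carrier V" by (intro span_is_subset2) auto
  ultimately have "gen_set {\<zero>\<^bsub>V\<^esub>}" by auto
  then have "dim \<le> card {\<zero>\<^bsub>V\<^esub>}" by (intro gen_ge_dim) auto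
  then show ?thesis by simp
qed

section \<open>Coordinates of \<open>K\<close>, \<open>H\<close> and \<open>D\<close>\<close>

context diagrams
begin

definition lin :: "'k \<Rightarrow> 'k \<Rightarrow> 'k \<Rightarrow> 'm arrow" where
  "lin x y z = x \<star> ident 2 \<boxplus> y \<star> \<tau> \<boxplus> z \<star> Ud"

lemma lin_add: "lin x y z \<boxplus> lin x' y' z' = lin (x + x') (y + y') (z + z')"
  unfolding lin_def add_smulA by (simp only: addA_assoc addA_left_commute addA_commute)

lemma lin_smul: "c \<star> lin x y z = lin (c * x) (c * y) (c * z)"
  by (simp add: lin_def smulA_add smulA_smulA)

lemma lin_simps [simp]: "valid (lin x y z)" "dm (lin x y z) = 2" "cd (lin x y z) = 2"
  by (simp_all add: lin_def eval_nat_numeral)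

lemma lin_cross: "lin x y z \<diamondop> \<tau> = lin y x z"
  by (simp add: lin_def cmpA_add_left cmpA_smul_left Ud_cross involution cmpA_ident_left
      eval_nat_numeral addA_commute)

lemma rot_add: "rot (f \<boxplus> g) = rot f \<boxplus> rot g"
  by (simp add: rot_def W_add cmpA_add_left cmpA_add_right)

lemma rot_smul: "rot (c \<star> f) = c \<star> rot f"
  by (simp add: rot_def W_smul cmpA_smul_left cmpA_smul_right)

lemma rot_lin: "rot (lin x y z) = lin z y x"
  unfolding lin_def rot_add rot_smul rot_ident rot_cross rot_Ud
  by (simp only: addA_assoc addA_left_commute addA_commute)

lemma bend_add: "bend (f \<boxplus> g) = bend f \<boxplus> bend g"
  by (simp add: bend_def W_add cmpA_add_right)

lemma bend_smul: "bend (c \<star> f) = c \<star> bend f"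
  by (simp add: bend_def W_smul cmpA_smul_right)

lemma ptr_Ud: "ptr Ud = ident 1"
proof -
  have "ptr Ud = (W 1 \<epsilon> 0 \<diamondop> W 0 \<eta> 1) \<diamondop> W 0 \<epsilon> 1 \<diamondop> W 1 \<eta> 0"
    by (simp add: ptr_def Ud_def layers)
  then show ?thesis by (simp only: zigzag1 zigzag2) (simp add: layers)
qed

lemma ptr_lin: "ptr (lin x y z) = (\<delta> * x + y + z) \<star> ident 1"
proof -
  have "ptr (lin x y z) = x \<star> ptr (ident 2) \<boxplus> y \<star> ptr \<tau> \<boxplus> z \<star> ptr Ud"
    by (simp add: lin_def ptr_def W_add W_smul cmpA_add_left cmpA_add_right cmpA_smul_left cmpA_smul_right)
  also have "\<dots> = (x * \<delta> + y + z) \<star> ident 1"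
    by (simp only: ptr_ident ptr_cross ptr_Ud smulA_smulA add_smulA)
  finally show ?thesis by (simp add: mult.commute)
qed

lemma cap_lin: "\<epsilon> \<diamondop> lin x y z = (x + y + \<delta> * z) \<star> \<epsilon>"
proof -
  have "\<epsilon> \<diamondop> Ud = \<delta> \<star> \<epsilon>"
    by (simp add: Ud_def cmpA_assoc[symmetric] loop cmpA_smul_left cmpA_ident_left)
  then have "\<epsilon> \<diamondop> lin x y z = x \<star> \<epsilon> \<boxplus> y \<star> \<epsilon> \<boxplus> z \<star> \<delta> \<star> \<epsilon>"
    by (simp add: lin_def cmpA_add_right cmpA_smul_right cap_sym cmpA_ident_right eval_nat_numeral)
  also have "\<dots> = (x + y + z * \<delta>) \<star> \<epsilon>" by (simp only: add_smulA smulA_smulA)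
  finally show ?thesis by (simp add: mult.commute)
qed

end

locale endo_basis = diagrams C \<mu> \<tau> \<eta> \<epsilon> \<delta> \<alpha>
  for C :: "(nat, 'm, 'k::field) lin_moncat" and \<mu> \<tau> \<eta> \<epsilon> \<delta> \<alpha> +
  assumes two: "(2::'k) \<noteq> 0" and delta: "\<delta> \<noteq> -2" and alpha: "\<alpha> \<noteq> 0"
    and nontrivial: "ident 1 \<noteq> zeroA 1 1"
begin

text \<open>
  The cup is symmetric and \<open>\<mu>\<close> is skew, so the composite is its own negative.
\<close>

lemma mult_cup: "\<mu> \<diamondop> \<eta> = zeroA 0 1"
proof -
  have "\<mu> \<diamondop> \<eta> = \<mu> \<diamondop> \<tau> \<diamondop> \<eta>" by (simp add: cup_sym)
  also have "\<dots> = (-1) \<star> (\<mu> \<diamondop> \<eta>)" by (simp add: cmpA_assoc[symmetric] mult_skew cmpA_smul_left)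
  finally have neg: "\<mu> \<diamondop> \<eta> = (-1) \<star> (\<mu> \<diamondop> \<eta>)" .
  have "2 \<star> (\<mu> \<diamondop> \<eta>) = \<mu> \<diamondop> \<eta> \<boxplus> \<mu> \<diamondop> \<eta>"
    using add_smulA[of 1 1 "\<mu> \<diamondop> \<eta>"] by (simp add: smulA_one)
  also have "\<dots> = \<mu> \<diamondop> \<eta> \<boxplus> (-1) \<star> (\<mu> \<diamondop> \<eta>)" using neg by simp
  also have "\<dots> = zeroA 0 1" by (simp add: add_neg)
  finally show ?thesis using two by (intro smulA_eq_zeroA[of 2 "\<mu> \<diamondop> \<eta>"]) simp_all
qed

lemma mult_lin: "\<mu> \<diamondop> lin x y z = (x - y) \<star> \<mu>"
proof -
  have "\<mu> \<diamondop> Ud = zeroA 2 1"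
    by (simp add: Ud_def cmpA_assoc[symmetric] mult_cup cmpA_zeroA_left eval_nat_numeral)
  then have "\<mu> \<diamondop> lin x y z = x \<star> \<mu> \<boxplus> y \<star> (-1) \<star> \<mu> \<boxplus> zeroA 2 1"
    by (simp add: lin_def cmpA_add_right cmpA_smul_right mult_skew cmpA_ident_right smulA_zeroA eval_nat_numeral)
  also have "\<dots> = x \<star> \<mu> \<boxplus> (- y) \<star> \<mu>"
    by (simp add: addA_zeroA smulA_smulA eval_nat_numeral)
  finally show ?thesis by (simp add: add_smulA[symmetric])
qed

lemma mult_nonzero: "\<mu> \<noteq> zeroA (dm \<mu>) (cd \<mu>)"
proof
  assume "\<mu> = zeroA (dm \<mu>) (cd \<mu>)"
  then have "\<mu> = zeroA 2 1" by (simp add: eval_nat_numeral)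
  moreover have "zeroA 2 1 \<diamondop> \<sigma> = zeroA 1 1" using cmpA_zeroA_left[of \<sigma> 2 1] by (simp add: eval_nat_numeral)
  ultimately have "\<mu> \<diamondop> \<sigma> = zeroA 1 1" by (simp only:)
  then have "\<alpha> \<star> ident 1 = zeroA 1 1" by (simp only: mult_sigma)
  then show False using nontrivial alpha smulA_eq_zeroA[of \<alpha> "ident 1"] by simp
qed

lemma cap_nonzero: "\<epsilon> \<noteq> zeroA (dm \<epsilon>) (cd \<epsilon>)"
proof
  assume "\<epsilon> = zeroA (dm \<epsilon>) (cd \<epsilon>)"
  then have "\<epsilon> = zeroA 2 0" by (simp add: eval_nat_numeral)
  then have "W 0 \<epsilon> 1 \<diamondop> W 1 \<eta> 0 = zeroA 1 1" by (simp add: W_zeroA cmpA_zeroA_left)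
  then show False using nontrivial by (simp only: zigzag1)
qed

text \<open>
  Composing with \<open>\<mu>\<close> identifies the first two coordinates, and after a quarter turn the last two; composing
  with the cap then kills the common value since \<open>\<delta> + 2\<close> is invertible.
\<close>

lemma lin_eq_zeroA:
  assumes "lin x y z = zeroA 2 2"
  shows "x = 0" "y = 0" "z = 0"
proof -
  have eq: "x' = y'" if "lin x' y' z' = zeroA 2 2" for x' y' z'
  proof -
    have "(x' - y') \<star> \<mu> = 0 \<star> \<mu>"
      using mult_lin[of x' y' z'] that by (simp add: cmpA_zeroA_right smulA_0 eval_nat_numeral)
    from smulA_inj[OF this _ mult_nonzero] show ?thesis by simp
  qed
  have "lin z y x = rot (zeroA 2 2)" using rot_lin[of x y z] assms by simp
  also have "\<dots> = zeroA 2 2"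
    by (simp add: rot_def W_zeroA cmpA_zeroA_left cmpA_zeroA_right eval_nat_numeral)
  finally have "x = y" "z = y" using eq assms by blast+
  moreover have "(x + y + \<delta> * z) \<star> \<epsilon> = 0 \<star> \<epsilon>"
    using cap_lin[of x y z] assms by (simp add: cmpA_zeroA_right smulA_0 eval_nat_numeral)
  from smulA_inj[OF this _ cap_nonzero] have "x + y + \<delta> * z = 0" by simp
  ultimately have "(\<delta> - (-2)) * x = 0" by (simp add: algebra_simps)
  moreover have "\<delta> - (-2) \<noteq> 0" using delta by (subst right_minus_eq)
  ultimately have "x = 0" by (simp only: mult_eq_0_iff) simp
  then show "x = 0" "y = 0" "z = 0" using \<open>x = y\<close> \<open>z = y\<close> by simp_all
qed

lemma lin_inj:
  assumes "lin x y z = lin x' y' z'"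
  shows "x = x'" "y = y'" "z = z'"
proof -
  have "lin (x - x') (y - y') (z - z') = lin x y z \<boxplus> (-1) \<star> lin x' y' z'"
    by (simp add: lin_smul lin_add)
  also have "\<dots> = zeroA 2 2" using assms add_neg[of "lin x' y' z'"] by simp
  finally show "x = x'" "y = y'" "z = z'" using lin_eq_zeroA by force+
qed

context
  assumes span: "\<exists>x y z. Kd = lin x y z"
begin

text \<open>
  Skew symmetry of \<open>K\<close> leaves one unknown coordinate, which composition with \<open>\<mu>\<close> determines.
\<close>

lemma Kd_eq_lin: "Kd = lin (\<alpha> / 2) (- \<alpha> / 2) 0"
proof -
  obtain x y z where K: "Kd = lin x y z" using span by blast
  have "lin y x z = lin (- x) (- y) (- z)"
    using Kd_cross by (simp add: K lin_cross lin_smul)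
  note y = lin_inj(1)[OF this] and z = lin_inj(3)[OF this]
  have "2 * z = 0" using arg_cong[OF z, of "\<lambda>t. t + z"] by simp
  then have z0: "z = 0" using two by simp
  have "\<mu> \<diamondop> Kd = (\<mu> \<diamondop> \<sigma>) \<diamondop> \<mu>" by (simp add: Kd_def cmpA_assoc)
  also have "\<dots> = \<alpha> \<star> \<mu>" by (simp add: mult_sigma cmpA_smul_left cmpA_ident_left)
  finally have "(x - y) \<star> \<mu> = \<alpha> \<star> \<mu>" by (simp add: K mult_lin)
  from smulA_inj[OF this _ mult_nonzero] have "x - y = \<alpha>" by simp
  then have "\<alpha> = x * 2" using y by (simp add: mult.commute)
  then have x: "x = \<alpha> / 2" using two by simp
  have "Kd = lin (\<alpha> / 2) (- (\<alpha> / 2)) 0" unfolding K y z0 x ..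
  then show ?thesis by (simp only: minus_divide_left)
qed

lemma Hd_eq_lin: "Hd = lin 0 (- \<alpha> / 2) (\<alpha> / 2)"
  using rot_Kd by (simp add: Kd_eq_lin rot_lin)

lemma Dd_eq_lin: "Dd = lin (\<alpha> / 2) 0 (- \<alpha> / 2)"
proof -
  have "(-1) \<star> Dd = lin (- \<alpha> / 2) 0 (\<alpha> / 2)" using Hd_cross by (simp add: Hd_eq_lin lin_cross)
  then have "(-1) \<star> (-1) \<star> Dd = lin (\<alpha> / 2) 0 (- \<alpha> / 2)" by (simp add: lin_smul)
  then show ?thesis by (simp add: smulA_smulA smulA_one)
qed

lemma Dd_eq: "Dd = Kd \<boxplus> (-1) \<star> Hd"
  by (simp add: Dd_eq_lin Kd_eq_lin Hd_eq_lin lin_smul lin_add)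

lemma Kd_eq: "Kd = (\<alpha> / 2) \<star> (ident 2 \<boxplus> (-1) \<star> \<tau>)"
proof -
  have "0 \<star> Ud = zeroA 2 2" using smulA_0[of Ud] by simp
  moreover have "ident 2 \<boxplus> (-1) \<star> \<tau> \<boxplus> zeroA 2 2 = ident 2 \<boxplus> (-1) \<star> \<tau>"
    by (rule addA_zeroA) simp_all
  ultimately have "ident 2 \<boxplus> (-1) \<star> \<tau> = ident 2 \<boxplus> (-1) \<star> \<tau> \<boxplus> 0 \<star> Ud"
    by (simp only:)
  also have "\<dots> = lin 1 (-1) 0" by (simp add: lin_def smulA_one)
  finally show ?thesis by (simp add: Kd_eq_lin lin_smul)
qed

text \<open>
  The partial traces of the two sides of the formula for \<open>K\<close> are \<open>\<alpha>1\<close> and \<open>(\<alpha>/2)(\<delta> - 1)1\<close>.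
\<close>

lemma delta_eq: "\<delta> = 3"
proof -
  have "\<alpha> \<star> ident 1 = (\<delta> * (\<alpha> / 2) - \<alpha> / 2) \<star> ident 1"
    using ptr_Kd ptr_lin[of "\<alpha> / 2" "- \<alpha> / 2" 0] by (simp add: Kd_eq_lin)
  then have eq: "\<alpha> = \<delta> * (\<alpha> / 2) - \<alpha> / 2"
    by (rule smulA_inj) (use nontrivial in simp_all)
  have "\<alpha> * (\<delta> - 3) = 2 * (\<delta> * (\<alpha> / 2) - \<alpha> / 2) - 2 * \<alpha>"
    using two by (simp add: field_simps)
  also have "\<dots> = 0" by (simp only: eq[symmetric] diff_self)
  finally have "\<alpha> * (\<delta> - 3) = 0" .
  then show ?thesis using alpha by simp
qed

lemma jacobi:
  "\<mu> \<diamondop> W 0 \<mu> 1 \<diamondop> W 1 \<tau> 0 = \<mu> \<diamondop> W 0 \<mu> 1 \<boxplus> (-1) \<star> (\<mu> \<diamondop> W 1 \<mu> 0)"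
  using arg_cong[OF Dd_eq, of bend] by (simp only: bend_add bend_smul bend_Dd bend_Kd bend_Hd)

end

end

section \<open>The braiding\<close>

context diagrams
begin

text \<open>
  The braidings of \<open>X\<close> past \<open>X\<^sup>\<otimes>\<^sup>n\<close> and of \<open>X\<^sup>\<otimes>\<^sup>m\<close> past \<open>X\<^sup>\<otimes>\<^sup>n\<close>.
\<close>

primrec strand :: "nat \<Rightarrow> 'm arrow" where
  "strand 0 = ident 1"
| "strand (Suc n) = W 1 (strand n) 0 \<diamondop> W 0 \<tau> n"

primrec braid :: "nat \<Rightarrow> nat \<Rightarrow> 'm arrow" where
  "braid 0 n = ident n"
| "braid (Suc m) n = W 0 (strand n) m \<diamondop> W 1 (braid m n) 0"

lemma strand_simps [simp]: "valid (strand n)" "dm (strand n) = Suc n" "cd (strand n) = Suc n"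
proof -
  have "valid (strand n) \<and> dm (strand n) = Suc n \<and> cd (strand n) = Suc n"
    by (induction n) auto
  then show "valid (strand n)" "dm (strand n) = Suc n" "cd (strand n) = Suc n" by simp_all
qed

lemma braid_simps [simp]: "valid (braid m n)" "dm (braid m n) = m + n" "cd (braid m n) = n + m"
proof -
  have "valid (braid m n) \<and> dm (braid m n) = m + n \<and> cd (braid m n) = n + m"
    by (induction m) auto
  then show "valid (braid m n)" "dm (braid m n) = m + n" "cd (braid m n) = n + m" by simp_all
qed

lemma strand_add: "strand (p + q) = W p (strand q) 0 \<diamondop> W 0 (strand p) q"
proof (induction p)
  case 0
  show ?case by (simp add: layers W_0)
next
  case (Suc p)
  have "strand (Suc p + q) = W 1 (W p (strand q) 0 \<diamondop> W 0 (strand p) q) 0 \<diamondop> W 0 \<tau> (p + q)"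
    using Suc by simp
  also have "\<dots> = W (Suc p) (strand q) 0 \<diamondop> W 0 (W 1 (strand p) 0 \<diamondop> W 0 \<tau> p) q"
    by (simp add: layers)
  finally show ?case by simp
qed

text \<open>
  The hexagon. In the induction step the first strand crosses the first \<open>n\<close> strands while the other \<open>m\<close>
  strands cross the last \<open>p\<close>; these two pieces are disjoint and can be interchanged.
\<close>

lemma braid_add_right: "braid m (n + p) = W n (braid m p) 0 \<diamondop> W 0 (braid m n) p"
proof (induction m)
  case 0
  show ?case by (simp add: layers)
next
  case (Suc m)
  have swap: "W 0 (strand n) (p + m) \<diamondop> W (1 + n) (braid m p) 0 =
      W (n + 1) (braid m p) 0 \<diamondop> W 0 (strand n) (m + p)"
    using W_exchange_gap[of 0 "strand n" 0 "braid m p" 0] by (simp add: ac_simps)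
  have "braid (Suc m) (n + p) =
      W n (strand p) m \<diamondop> (W 0 (strand n) (p + m) \<diamondop> W (1 + n) (braid m p) 0) \<diamondop> W 1 (braid m n) p"
    by (simp add: Suc strand_add layers)
  also have "\<dots> = W n (strand p) m \<diamondop> W (n + 1) (braid m p) 0 \<diamondop> W 0 (strand n) (m + p) \<diamondop> W 1 (braid m n) p"
    by (simp only: swap cmpA_assoc)
  also have "\<dots> = W n (braid (Suc m) p) 0 \<diamondop> W 0 (braid (Suc m) n) p"
    by (simp add: layers)
  finally show ?case .
qed

lemma strand_braid_inverse: "braid n 1 \<diamondop> strand n = ident (Suc n)"
proof (induction n)
  case 0
  show ?case by (simp add: layers)
next
  case (Suc n)
  have s1: "strand 1 = \<tau>" by (simp add: layers W_0)
  have "braid (Suc n) 1 \<diamondop> strand (Suc n) = W 0 \<tau> n \<diamondop> W 1 (braid n 1 \<diamondop> strand n) 0 \<diamondop> W 0 \<tau> n"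
    using s1 by (simp add: layers)
  also have "\<dots> = ident (Suc (Suc n))"
    by (simp only: Suc) (simp add: layers involution_W)
  finally show ?case .
qed

lemma braid_inverse: "braid n m \<diamondop> braid m n = ident (m + n)"
proof (induction m)
  case 0
  have "braid n 0 = ident n"
    by (induction n) (simp_all add: layers)
  then show ?case by (simp add: layers)
next
  case (Suc m)
  have "braid n (Suc m) = W 1 (braid n m) 0 \<diamondop> W 0 (braid n 1) m"
    using braid_add_right[of n 1 m] by simp
  then have "braid n (Suc m) \<diamondop> braid (Suc m) n =
      W 1 (braid n m) 0 \<diamondop> W 0 (braid n 1 \<diamondop> strand n) m \<diamondop> W 1 (braid m n) 0"
    by (simp add: layers)
  also have "\<dots> = W 1 (braid n m \<diamondop> braid m n) 0"
    by (simp only: strand_braid_inverse) (simp add: layers)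
  also have "\<dots> = ident (Suc m + n)" by (simp add: Suc layers)
  finally show ?case .
qed

text \<open>
  Naturality of the braiding of a single strand with respect to one arrow. It is a property closed under
  all operations on arrows, so that it suffices to know it for the generators.
\<close>

definition slides :: "'m arrow \<Rightarrow> bool" where
  "slides f \<longleftrightarrow> valid f \<and> strand (cd f) \<diamondop> W 1 f 0 = W 0 f 1 \<diamondop> strand (dm f)"

lemma slides_ident: "slides (ident n)"
  by (simp add: slides_def layers)

lemma slides_zeroA: "slides (zeroA m n)"
  by (simp add: slides_def W_zeroA cmpA_zeroA_left cmpA_zeroA_right)

lemma slides_cmpA:
  assumes f: "slides f" and g: "slides g" and eq: "cd f = dm g"
  shows "slides (g \<diamondop> f)"
proof -
  have "strand (cd g) \<diamondop> W 1 g 0 \<diamondop> W 1 f 0 = W 0 g 1 \<diamondop> strand (cd f) \<diamondop> W 1 f 0"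
    using g eq unfolding slides_def by (simp add: cmpA_assoc[symmetric])
  also have "\<dots> = W 0 g 1 \<diamondop> W 0 f 1 \<diamondop> strand (dm f)" using f by (simp add: slides_def)
  finally show ?thesis using f g eq by (simp add: slides_def layers)
qed

text \<open>
  A strand crossing \<open>a + n + b\<close> strands crosses the three groups one after another; it commutes with \<open>f\<close> in the
  outer groups by exchange and in the middle one by assumption.
\<close>

lemma slides_W:
  assumes "slides f"
  shows "slides (W a f b)"
proof -
  have v: "valid f" and eq: "strand (cd f) \<diamondop> W 1 f 0 = W 0 f 1 \<diamondop> strand (dm f)"
    using assms by (simp_all add: slides_def)
  have right: "strand (c + b) = W c (strand b) 0 \<diamondop> W 0 (strand c) b" for c
    by (rule strand_add)
  have left: "strand (a + c) = W a (strand c) 0 \<diamondop> W 0 (strand a) c" for c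
    by (rule strand_add)
  have ex1: "W (a + cd f) (strand b) 0 \<diamondop> W a f (Suc b) = W a f (Suc b) \<diamondop> W (a + dm f) (strand b) 0"
    using W_exchange_gap[of a f 0 "strand b" 0] by simp
  have ex2: "W 0 (strand a) (cd f + b) \<diamondop> W (Suc a) f b = W (Suc a) f b \<diamondop> W 0 (strand a) (dm f + b)"
    using W_exchange_gap[of 0 "strand a" 0 f b] by simp
  have "strand (a + cd f + b) \<diamondop> W (Suc a) f b =
      W (a + cd f) (strand b) 0 \<diamondop> W a (strand (cd f)) b \<diamondop>
        (W 0 (strand a) (cd f + b) \<diamondop> W (Suc a) f b)"
    by (simp add: right left layers)
  also have "\<dots> = W (a + cd f) (strand b) 0 \<diamondop> W a (strand (cd f) \<diamondop> W 1 f 0) b \<diamondop> W 0 (strand a) (dm f + b)"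
    by (simp only: ex2) (simp add: layers)
  also have "\<dots> = (W (a + cd f) (strand b) 0 \<diamondop> W a f (Suc b)) \<diamondop> W a (strand (dm f)) b \<diamondop> W 0 (strand a) (dm f + b)"
    by (simp only: eq) (simp add: layers)
  also have "\<dots> = W a f (Suc b) \<diamondop> strand (a + dm f + b)"
    by (simp only: ex1) (simp add: right left layers)
  finally show ?thesis using v by (simp add: slides_def layers)
qed

lemma slides_addA:
  assumes "slides f" "slides g" "dm f = dm g" "cd f = cd g"
  shows "slides (f \<boxplus> g)"
  using assms by (simp add: slides_def W_add cmpA_add_left cmpA_add_right)

lemma slides_smulA:
  assumes "slides f"
  shows "slides (c \<star> f)"
  using assms by (simp add: slides_def W_smul cmpA_smul_left cmpA_smul_right)

lemma strand_1: "strand (Suc 0) = \<tau>"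
  by (simp add: layers W_0)

lemma strand_2: "strand (Suc (Suc 0)) = W (Suc 0) \<tau> 0 \<diamondop> W 0 \<tau> (Suc 0)"
  by (simp add: layers)

lemma slides_cross: "slides \<tau>"
  using braid_rel by (simp add: slides_def strand_2 cmpA_assoc del: strand.simps)

lemma slides_mult: "slides \<mu>"
proof -
  have "W 0 \<mu> 1 = \<tau> \<diamondop> \<tau> \<diamondop> W 0 \<mu> 1"
    by (simp add: cmpA_assoc[symmetric] involution cmpA_ident_left eval_nat_numeral)
  also have "\<dots> = \<tau> \<diamondop> W 1 \<mu> 0 \<diamondop> W 0 \<tau> 1 \<diamondop> W 1 \<tau> 0" by (simp only: mult_slide)
  finally have eq: "W 0 \<mu> 1 = \<tau> \<diamondop> W 1 \<mu> 0 \<diamondop> W 0 \<tau> 1 \<diamondop> W 1 \<tau> 0" .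
  have "W 0 \<mu> 1 \<diamondop> W 1 \<tau> 0 \<diamondop> W 0 \<tau> 1 = \<tau> \<diamondop> W 1 \<mu> 0"
    by (simp only: eq) (simp add: layers involution_W involution_W[THEN tail2])
  then show ?thesis by (simp add: slides_def strand_1 strand_2 del: strand.simps)
qed

lemma slides_cap: "slides \<epsilon>"
proof -
  have "W 0 \<epsilon> 1 \<diamondop> W 1 \<tau> 0 \<diamondop> W 0 \<tau> 1 = W 1 \<epsilon> 0 \<diamondop> W 0 \<tau> 1 \<diamondop> W 0 \<tau> 1"
    using cap_slide_W[of 0 0, THEN tail2, of "W 0 \<tau> 1"] by (simp add: cmpA_assoc)
  also have "\<dots> = W 1 \<epsilon> 0" by (simp add: layers involution_W)
  finally show ?thesis by (simp add: slides_def strand_2 layers)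
qed

lemma slides_cup: "slides \<eta>"
proof -
  have "W 1 \<tau> 0 \<diamondop> W 0 \<tau> 1 \<diamondop> W 1 \<eta> 0 = W 1 \<tau> 0 \<diamondop> W 1 \<tau> 0 \<diamondop> W 0 \<eta> 1"
    using cup_slide_W[of 0 0] by simp
  also have "\<dots> = W 0 \<eta> 1" by (simp add: layers involution_W[THEN tail2])
  finally show ?thesis by (simp add: slides_def strand_2 layers)
qed

lemma braid_natural_right:
  assumes "slides f"
  shows "braid m (cd f) \<diamondop> W m f 0 = W 0 f m \<diamondop> braid m (dm f)"
proof (induction m)
  case 0
  show ?case using assms by (simp add: slides_def layers)
next
  case (Suc m)
  have v: "valid f" and eq: "strand (cd f) \<diamondop> W 1 f 0 = W 0 f 1 \<diamondop> strand (dm f)"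
    using assms by (simp_all add: slides_def)
  have "braid (Suc m) (cd f) \<diamondop> W (Suc m) f 0 =
      W 0 (strand (cd f)) m \<diamondop> W 1 (braid m (cd f) \<diamondop> W m f 0) 0"
    by (simp add: layers)
  also have "\<dots> = W 0 (strand (cd f) \<diamondop> W 1 f 0) m \<diamondop> W 1 (braid m (dm f)) 0"
    by (simp only: Suc) (simp add: layers)
  also have "\<dots> = W 0 f (Suc m) \<diamondop> braid (Suc m) (dm f)"
    by (simp only: eq) (simp add: layers)
  finally show ?case .
qed

text \<open>
  Naturality in the first argument follows from naturality in the second one by
  conjugating with the inverse braiding.
\<close>

lemma braid_natural_left:
  assumes "slides f"
  shows "braid (cd f) n \<diamondop> W 0 f n = W n f 0 \<diamondop> braid (dm f) n"
proof -
  have v: "valid f" using assms by (simp add: slides_def)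
  have "braid (cd f) n \<diamondop> W 0 f n = braid (cd f) n \<diamondop> (W 0 f n \<diamondop> braid n (dm f)) \<diamondop> braid (dm f) n"
    using v by (simp add: cmpA_assoc braid_inverse layers add.commute)
  also have "\<dots> = (braid (cd f) n \<diamondop> braid n (cd f)) \<diamondop> W n f 0 \<diamondop> braid (dm f) n"
    by (simp only: braid_natural_right[OF assms, symmetric] cmpA_assoc)
  also have "\<dots> = W n f 0 \<diamondop> braid (dm f) n"
    using v by (simp add: braid_inverse layers)
  finally show ?thesis .
qed

lemma braid_natural:
  assumes f: "slides f" and g: "slides g"
  shows "braid (cd f) (cd g) \<diamondop> W 0 f (cd g) \<diamondop> W (dm f) g 0 =
    (W 0 g (cd f) \<diamondop> W (dm g) f 0) \<diamondop> braid (dm f) (dm g)"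
proof -
  have "braid (cd f) (cd g) \<diamondop> W 0 f (cd g) \<diamondop> W (dm f) g 0 =
      W (cd g) f 0 \<diamondop> braid (dm f) (cd g) \<diamondop> W (dm f) g 0"
    using braid_natural_left[OF f, THEN tail2] by (simp add: cmpA_assoc)
  also have "\<dots> = W (cd g) f 0 \<diamondop> W 0 g (dm f) \<diamondop> braid (dm f) (dm g)"
    using braid_natural_right[OF g] by simp
  also have "\<dots> = (W (cd g) f 0 \<diamondop> W 0 g (dm f)) \<diamondop> braid (dm f) (dm g)"
    by (simp only: cmpA_assoc)
  also have "W (cd g) f 0 \<diamondop> W 0 g (dm f) = W 0 g (cd f) \<diamondop> W (dm g) f 0"
    by (rule W_exchange_adjacent[symmetric])
  finally show ?thesis .
qed

end

section \<open>Arrows named by terms\<close>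

primrec src :: "'k tm \<Rightarrow> nat" where
  "src (TId n) = n" | "src TM = 2" | "src TS = 2" | "src TEta = 0" | "src TEps = 2"
| "src (g \<cdot> f) = src f" | "src (f \<otimes>\<^sub>t g) = src f + src g" | "src (TZero m n) = m"
| "src (TAdd f g) = src f" | "src (TSmul c f) = src f"

primrec tgt :: "'k tm \<Rightarrow> nat" where
  "tgt (TId n) = n" | "tgt TM = 1" | "tgt TS = 2" | "tgt TEta = 2" | "tgt TEps = 0"
| "tgt (g \<cdot> f) = tgt g" | "tgt (f \<otimes>\<^sub>t g) = tgt f + tgt g" | "tgt (TZero m n) = n"
| "tgt (TAdd f g) = tgt f" | "tgt (TSmul c f) = tgt f"

primrec ok :: "'k tm \<Rightarrow> bool" where
  "ok (TId n) = True" | "ok TM = True" | "ok TS = True" | "ok TEta = True" | "ok TEps = True"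
| "ok (g \<cdot> f) = (ok g \<and> ok f \<and> src g = tgt f)" | "ok (f \<otimes>\<^sub>t g) = (ok f \<and> ok g)"
| "ok (TZero m n) = True"
| "ok (TAdd f g) = (ok f \<and> ok g \<and> src g = src f \<and> tgt g = tgt f)" | "ok (TSmul c f) = ok f"

text \<open>
  Typing becomes computable: a term has at most one type, and the simplifier can find it.
\<close>

lemma wt_iff: "wt f m n \<longleftrightarrow> ok f \<and> m = src f \<and> n = tgt f"
proof
  show "wt f m n \<Longrightarrow> ok f \<and> m = src f \<and> n = tgt f" by (induction rule: wt.induct) auto
  have "ok t \<Longrightarrow> wt t (src t) (tgt t)" for t :: "'a tm"
  proof (induction t)
    case TM
    then show ?case using wt.intros(2) by simp
  next
    case (TComp g f)
    then show ?case by (auto intro: wt.intros)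
  next
    case (TAdd f g)
    then show ?case by (auto intro!: wt.intros)
  qed (auto intro!: wt.intros)
  then show "ok f \<and> m = src f \<and> n = tgt f \<Longrightarrow> wt f m n" by simp
qed

lemma src_tbraid1 [simp]: "src (tbraid1 n) = Suc n"
  by (cases n) simp_all

lemma tgt_tbraid1 [simp]: "tgt (tbraid1 n) = Suc n"
  by (induction n) simp_all

lemma ok_tbraid1 [simp]: "ok (tbraid1 n)"
  by (induction n) simp_all

lemma src_tbraid [simp]: "src (tbraid m n) = m + n"
  by (induction m) simp_all

lemma tgt_tbraid [simp]: "tgt (tbraid m n) = n + m"
  by (cases m) simp_all

lemma ok_tbraid [simp]: "ok (tbraid m n)"
  by (induction m) simp_all

context term_presentation
begin

sublocale tensor_powers C
  by (rule tensor_powers.intro[OF strict_lin_moncat]) (unfold_locales, simp_all add: unt otm)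

definition ar :: "'k tm \<Rightarrow> 'm arrow" where
  "ar f = Arr (src f) (tgt f) (P (src f) (tgt f) f)"

lemma P_mor: "ok f \<Longrightarrow> P (src f) (tgt f) f \<in> Mor C (src f) (tgt f)"
  by (rule mor_I) (simp add: wt_iff)

lemma ar_simps [simp]: "ok f \<Longrightarrow> valid (ar f)" "dm (ar f) = src f" "cd (ar f) = tgt f"
  by (simp_all add: ar_def P_mor)

lemma ar_cmp: "\<lbrakk>ok f; ok g; src g = tgt f\<rbrakk> \<Longrightarrow> ar g \<diamondop> ar f = ar (g \<cdot> f)"
  using P_mor[of g] P_mor[of f] by (simp add: ar_def cmp wt_iff)

lemma ar_tens: "\<lbrakk>ok f; ok g\<rbrakk> \<Longrightarrow> ar (f \<otimes>\<^sub>t g) = W 0 (ar f) (tgt g) \<diamondop> W (src f) (ar g) 0"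
  using tns_via_W(1)[OF P_mor[of f] P_mor[of g]] by (simp add: ar_def tns wt_iff)

lemma ar_ident: "ident n = ar (TId n)"
  by (simp add: ident_def ar_def idn)

lemma ar_zero: "zeroA m n = ar (TZero m n)"
  by (simp add: zeroA_def ar_def zero)

lemma ar_add: "\<lbrakk>ok f; ok g; src g = src f; tgt g = tgt f\<rbrakk> \<Longrightarrow> ar f \<boxplus> ar g = ar (TAdd f g)"
  using P_mor[of f] P_mor[of g] by (simp add: ar_def add wt_iff)

lemma ar_smul: "ok f \<Longrightarrow> c \<star> ar f = ar (TSmul c f)"
  using P_mor[of f] by (simp add: ar_def smult wt_iff)

lemma ar_whisker_right: "ok f \<Longrightarrow> W 0 (ar f) b = ar (f \<otimes>\<^sub>t TId b)"
  using ar_tens[of f "TId b"] by (simp add: ar_ident[symmetric] W_ident cmpA_ident_right)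

lemma ar_whisker_left: "ok f \<Longrightarrow> W a (ar f) 0 = ar (TId a \<otimes>\<^sub>t f)"
  using ar_tens[of "TId a" f] by (simp add: ar_ident[symmetric] W_ident cmpA_ident_left)

lemma ar_eqI:
  assumes "teq \<delta> \<alpha> (src f) (tgt f) f g" "src g = src f" "tgt g = tgt f"
  shows "ar f = ar g"
  using eqI[OF assms(1)] assms(2,3) by (simp add: ar_def)

lemma ar_relation:
  assumes "defining_rel \<delta> \<alpha> f g" "ok f" "ok g" "src g = src f" "tgt g = tgt f"
  shows "ar f = ar g"
  using assms by (intro ar_eqI teq.relation) (simp_all add: wt_iff)

lemmas ar_eval = ar_cmp ar_whisker_left ar_whisker_right ar_ident ar_smul

lemmas ar_relations = defining_rel.intros[THEN ar_relation, unfolded t\<sigma>_def, simplified]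

sublocale diagrams C "ar TM" "ar TS" "ar TEta" "ar TEps" \<delta> \<alpha>
proof
  have "ar (\<I> \<otimes>\<^sub>t \<I>) = ar (TId 2)"
    using teq.tens_id[of \<delta> \<alpha> 1 1] by (intro ar_eqI) (simp_all add: one_add_one[symmetric] del: one_add_one)
  then show "ar TS \<diamondop> ar TS = ident 2" using ar_relations(5) by (simp add: ar_eval)
  show "W 1 (ar TS) 0 \<diamondop> W 0 (ar TS) 1 \<diamondop> W 1 (W 1 (ar TM) 0 \<diamondop> W 0 (ar TEta) 1) 0 =
      W 0 (W 1 (ar TM) 0 \<diamondop> W 0 (ar TEta) 1) 1 \<diamondop> ar TS"
    using ar_relations(8) by (simp add: ar_eval)
  show "ar TM \<diamondop> W 1 (ar TM) 0 \<diamondop> W 0 (ar TEta) 1 = \<alpha> \<star> ident 1"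
    using ar_relations(11) by (simp add: ar_eval)
qed (simp_all add: ar_eval ar_relations)

lemma sigma_ar: "ar t\<sigma> = \<sigma>"
  by (simp add: \<sigma>_def t\<sigma>_def ar_eval)

lemma ok_sigma [simp]: "ok t\<sigma>" "src t\<sigma> = 1" "tgt t\<sigma> = 2"
  by (simp_all add: t\<sigma>_def)

lemma Kd_ar: "Kd = ar tK"
  by (simp add: Kd_def sigma_ar[symmetric] tK_def ar_eval)

lemma Hd_ar: "Hd = ar tH"
  by (simp add: Hd_def sigma_ar[symmetric] tH_def ar_eval)

lemma Dd_ar: "Dd = ar tD"
  by (simp add: Dd_def sigma_ar[symmetric] tD_def ar_eval)

lemma ok_endo [simp]: "ok tK" "src tK = 2" "tgt tK = 2" "ok tH" "src tH = 2" "tgt tH = 2"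
  "ok tD" "src tD = 2" "tgt tD = 2"
  by (simp_all add: tK_def tH_def tD_def)

subsection \<open>Symmetry\<close>

lemma slides_ar: "ok t \<Longrightarrow> slides (ar t)"
proof (induction t)
  case (TId n)
  show ?case using slides_ident[of n] by (simp add: ar_ident)
next
  case (TComp g f)
  then show ?case using slides_cmpA[of "ar f" "ar g"] by (simp add: ar_cmp)
next
  case (TTens f g)
  then show ?case
    using slides_cmpA[OF slides_W[of "ar g" "src f" 0] slides_W[of "ar f" 0 "tgt g"]]
    by (simp add: ar_tens)
next
  case (TZero m n)
  show ?case using slides_zeroA[of m n] by (simp add: ar_zero)
next
  case (TAdd f g)
  then show ?case using slides_addA[of "ar f" "ar g"] by (simp add: ar_add)
next
  case (TSmul c f)
  then show ?case using slides_smulA[of "ar f" c] by (simp add: ar_smul)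
qed (auto intro: slides_mult slides_cross slides_cup slides_cap)

lemma strand_ar: "strand n = ar (tbraid1 n)"
  by (induction n) (simp_all add: ar_eval)

lemma braid_ar: "braid m n = ar (tbraid m n)"
  by (induction m) (simp_all add: ar_eval strand_ar)

definition br :: "nat \<Rightarrow> nat \<Rightarrow> 'm" where
  "br m n = P (m + n) (n + m) (tbraid m n)"

lemma br_mor: "br m n \<in> Mor C (m + n) (n + m)"
  unfolding br_def by (rule mor_I) (simp add: wt_iff)

lemma braid_br: "braid m n = Arr (m + n) (n + m) (br m n)"
  by (simp only: braid_ar) (simp add: ar_def br_def)

lemma slides_mor: "f \<in> Mor C m n \<Longrightarrow> slides (Arr m n f)"
  using slides_ar by (elim mor_cases) (auto simp: ar_def wt_iff)

lemma symmetric_lin_moncat: "symmetric_lin_moncat C br"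
proof (rule symmetric_lin_moncat.intro[OF strict_lin_moncat], rule symmetric_lin_moncat_axioms.intro)
  fix X Y Z X' Y' :: nat and f f'
  show "br X Y \<in> Mor C (Otm C X Y) (Otm C Y X)" by (simp add: otm br_mor)
  show "Cmp C (Otm C X X') (Otm C Y Y') (Otm C Y' Y) (br Y Y') (Tns C X Y X' Y' f f') =
      Cmp C (Otm C X X') (Otm C X' X) (Otm C Y' Y) (Tns C X' Y' X Y f' f) (br X X')"
    if "f \<in> Mor C X Y" "f' \<in> Mor C X' Y'"
    using braid_natural[OF slides_mor[OF that(1)] slides_mor[OF that(2)]] that
    by (simp add: tns_via_W(1)[symmetric] braid_br br_mor tns_mor otm del: W.simps)
  show "Cmp C (Otm C X Y) (Otm C Y X) (Otm C X Y) (br Y X) (br X Y) = Idn C (Otm C X Y)"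
    using braid_inverse[of Y X] by (simp add: braid_br br_mor otm ident_def)
  have "Arr (X + Y + Z) (Y + Z + X) (br X (Y + Z)) =
      Arr (Y + (X + Z)) (Y + (Z + X)) (Tns C Y Y (X + Z) (Z + X) (Idn C Y) (br X Z)) \<diamondop>
      Arr (X + Y + Z) (Y + X + Z) (Tns C (X + Y) (Y + X) Z Z (br X Y) (Idn C Z))"
    using braid_add_right[of X Y Z] tns_via_W(1)[OF idn_closed[of Y] br_mor[of X Z]]
      tns_via_W(1)[OF br_mor[of X Y] idn_closed[of Z]]
    by (simp add: braid_br ident_def[symmetric] W_ident cmpA_ident_left cmpA_ident_right br_mor add.assoc
        del: W.simps)
  then show "br X (Otm C Y Z) =
      Cmp C (Otm C (Otm C X Y) Z) (Otm C (Otm C Y X) Z) (Otm C (Otm C Y Z) X)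
        (Tns C Y Y (Otm C X Z) (Otm C Z X) (Idn C Y) (br X Z))
        (Tns C (Otm C X Y) (Otm C Y X) Z Z (br X Y) (Idn C Z))"
    using tns_mor[OF idn_closed[of Y] br_mor[of X Z]] tns_mor[OF br_mor[of X Y] idn_closed[of Z]]
    by (simp add: otm add.assoc)
qed

end

section \<open>The relations in the quotient\<close>

context term_presentation
begin

lemma neg: "wt f m n \<Longrightarrow> \<ominus>\<^bsub>Hom C m n\<^esub> P m n f = P m n (TSmul (-1) f)"
  by (simp add: hom_neg mor_I smult)

lemma minus: "\<lbrakk>wt f m n; wt g m n\<rbrakk> \<Longrightarrow>
    P m n f \<ominus>\<^bsub>Hom C m n\<^esub> P m n g = P m n (TAdd f (TSmul (-1) g))"
  by (simp add: a_minus_def neg add wt.intros)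

lemma P_eqI: "\<lbrakk>ar f = ar g; src f = m; tgt f = n\<rbrakk> \<Longrightarrow> P m n f = P m n g"
  by (auto simp: ar_def)

lemmas P_eval = cmp tns idn smult add neg minus wt_iff unt otm

end

locale three_dimensional_presentation = term_presentation \<delta> \<alpha> C P
  for \<delta> \<alpha> :: "'k::field" and C :: "(nat, 'm, 'k) lin_moncat" and P +
  assumes two: "(2::'k) \<noteq> 0" and delta: "\<delta> \<noteq> -2" and alpha: "\<alpha> \<noteq> 0"
    and fin_dim: "vectorspace.fin_dim class_ring (Hom C 2 2)"
    and dim: "vectorspace.dim class_ring (Hom C 2 2) = 3"
begin

sublocale endo_basis C "ar TM" "ar TS" "ar TEta" "ar TEps" \<delta> \<alpha>
proof
  show "ident 1 \<noteq> zeroA 1 1"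
  proof
    assume "ident 1 = zeroA 1 1"
    then have "W 1 (ident 1) 0 = W 1 (zeroA 1 1) 0" by simp
    then have z: "ident 2 = zeroA 2 2" by (simp add: W_ident W_zeroA eval_nat_numeral)
    have "f = \<zero>\<^bsub>Hom C 2 2\<^esub>" if "f \<in> Mor C 2 2" for f
    proof -
      have "Arr 2 2 f = ident 2 \<diamondop> Arr 2 2 f" using that by (simp add: cmpA_ident_left)
      also have "\<dots> = zeroA 2 2" unfolding z using that by (simp add: cmpA_zeroA_left)
      finally show ?thesis by (simp add: zeroA_def)
    qed
    then have "Mor C 2 2 \<subseteq> {\<zero>\<^bsub>Hom C 2 2\<^esub>}" by blast
    from dim_le_1_of_trivial[OF hom_vs this] show False using dim by simp
  qed
qed (fact two delta alpha)+

text \<open>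
  Independence of \<open>1\<close>, \<open>\<tau>\<close>, \<open>U\<close> among arrows is independence of their representatives in the hom space; in
  dimension three they span it.
\<close>

lemma Kd_in_span: "\<exists>x y z. Kd = lin x y z"
proof -
  define U where "U = P 2 2 (TEta \<cdot> TEps)"
  have mor: "Idn C 2 \<in> Mor C 2 2" "P 2 2 TS \<in> Mor C 2 2" "U \<in> Mor C 2 2" "P 2 2 tK \<in> Mor C 2 2"
    by (auto simp: U_def idn wt_iff intro!: mor_I)
  have ars: "ar TS = Arr 2 2 (P 2 2 TS)" "Ud = Arr 2 2 U" "Kd = Arr 2 2 (P 2 2 tK)"
    by (simp_all add: Ud_def ar_eval Kd_ar) (simp_all add: ar_def U_def)
  have lin: "lin x y z = Arr 2 2 (x \<odot>\<^bsub>Hom C 2 2\<^esub> Idn C 2 \<oplus>\<^bsub>Hom C 2 2\<^esub>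
      (y \<odot>\<^bsub>Hom C 2 2\<^esub> P 2 2 TS \<oplus>\<^bsub>Hom C 2 2\<^esub> z \<odot>\<^bsub>Hom C 2 2\<^esub> U))" for x y z
    unfolding lin_def unfolding ars ident_def using mor by (simp add: closed hom_add_assoc)
  have "\<exists>x y z. P 2 2 tK = x \<odot>\<^bsub>Hom C 2 2\<^esub> Idn C 2 \<oplus>\<^bsub>Hom C 2 2\<^esub>
      (y \<odot>\<^bsub>Hom C 2 2\<^esub> P 2 2 TS \<oplus>\<^bsub>Hom C 2 2\<^esub> z \<odot>\<^bsub>Hom C 2 2\<^esub> U)"
  proof (rule independent_triple_spans[OF hom_vs fin_dim dim mor(1-3) _ mor(4)])
    fix x y z
    assume "x \<odot>\<^bsub>Hom C 2 2\<^esub> Idn C 2 \<oplus>\<^bsub>Hom C 2 2\<^esub>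
      (y \<odot>\<^bsub>Hom C 2 2\<^esub> P 2 2 TS \<oplus>\<^bsub>Hom C 2 2\<^esub> z \<odot>\<^bsub>Hom C 2 2\<^esub> U) = \<zero>\<^bsub>Hom C 2 2\<^esub>"
    then have "lin x y z = zeroA 2 2" by (simp add: lin zeroA_def)
    from lin_eq_zeroA[OF this] show "x = 0 \<and> y = 0 \<and> z = 0" by simp
  qed
  then obtain x y z where "P 2 2 tK = x \<odot>\<^bsub>Hom C 2 2\<^esub> Idn C 2 \<oplus>\<^bsub>Hom C 2 2\<^esub>
      (y \<odot>\<^bsub>Hom C 2 2\<^esub> P 2 2 TS \<oplus>\<^bsub>Hom C 2 2\<^esub> z \<odot>\<^bsub>Hom C 2 2\<^esub> U)" by blast
  then have "Kd = lin x y z" unfolding lin ars(3) by simp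
  then show ?thesis by blast
qed

lemma delta_eq_3: "\<delta> = 3"
  by (rule delta_eq[OF Kd_in_span])

lemma crossed_H_relation: "P 2 2 tD = P 2 2 tK \<ominus>\<^bsub>Hom C 2 2\<^esub> P 2 2 tH"
  using P_eqI[of tD "TAdd tK (TSmul (-1) tH)" 2 2] Dd_eq[OF Kd_in_span]
  by (simp add: P_eval Dd_ar Kd_ar Hd_ar ar_smul ar_add)

lemma K_relation: "P 2 2 tK = (\<alpha> / 2) \<odot>\<^bsub>Hom C 2 2\<^esub> (Idn C 2 \<ominus>\<^bsub>Hom C 2 2\<^esub> P 2 2 TS)"
  using P_eqI[of tK "TSmul (\<alpha> / 2) (TAdd (TId 2) (TSmul (-1) TS))" 2 2] Kd_eq[OF Kd_in_span]
  by (simp add: P_eval Kd_ar ar_ident ar_smul ar_add)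

lemma lie_algebra: "lie_algebra_object C br 1 (P 2 1 TM)"
proof -
  have br: "br 1 1 = P 2 2 TS"
  proof -
    have "ar (tbraid 1 1) = ar TS" using braid_ar[of 1 1] by (simp add: layers W_0)
    from P_eqI[OF this, of 2 2] show ?thesis by (simp add: br_def eval_nat_numeral)
  qed
  have skew: "P 2 1 (TM \<cdot> TS) = P 2 1 (TSmul (-1) TM)"
    using P_eqI[of "TM \<cdot> TS" "TSmul (-1) TM" 2 1] mult_skew by (simp add: ar_eval)
  have jac: "P 3 1 (TM \<cdot> (TM \<otimes>\<^sub>t \<I>) \<cdot> (\<I> \<otimes>\<^sub>t TS)) =
      P 3 1 (TAdd (TM \<cdot> (TM \<otimes>\<^sub>t \<I>)) (TSmul (-1) (TM \<cdot> (\<I> \<otimes>\<^sub>t TM))))"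
    using jacobi[OF Kd_in_span] by (intro P_eqI) (simp_all add: ar_eval ar_add)
  show ?thesis
    unfolding lie_algebra_object_def Let_def
    using symmetric_lin_moncat skew jac
    by (simp add: br P_eval mor_I del: One_nat_def)
qed

lemma selfdual: "selfdual_of_dimension C 1 (P 0 2 TEta) (P 2 0 TEps) 3"
proof -
  have "P 1 1 ((TEps \<otimes>\<^sub>t \<I>) \<cdot> (\<I> \<otimes>\<^sub>t TEta)) = P 1 1 \<I>"
    using zigzag1 by (intro P_eqI) (simp_all add: ar_eval)
  moreover have "P 1 1 ((\<I> \<otimes>\<^sub>t TEps) \<cdot> (TEta \<otimes>\<^sub>t \<I>)) = P 1 1 \<I>"
    using zigzag2 by (intro P_eqI) (simp_all add: ar_eval)
  moreover have "P 0 0 (TEps \<cdot> TEta) = P 0 0 (TSmul 3 (TId 0))"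
    using loop by (intro P_eqI) (simp_all add: ar_eval delta_eq_3)
  ultimately show ?thesis
    unfolding selfdual_of_dimension_def Let_def
    by (simp add: P_eval mor_I del: One_nat_def)
qed

end

theorem proposition3p9:
  fixes \<delta> \<alpha> :: "'k::field" and J :: "nat \<Rightarrow> nat \<Rightarrow> 'k tm set set"
  assumes "CHAR('k) \<noteq> 2" and "\<delta> \<noteq> -2" and "\<alpha> \<noteq> 0"
    and "tensor_ideal (Tcat \<delta> \<alpha>) J"
    and "vectorspace.fin_dim class_ring (Hom (quot_cat (Tcat \<delta> \<alpha>) J) 2 2)"
    and "vectorspace.dim class_ring (Hom (quot_cat (Tcat \<delta> \<alpha>) J) 2 2) = 3"
  shows "let Q = quot_cat (Tcat \<delta> \<alpha>) J;
             \<pi> = (\<lambda>m n f. quot_mor (Tcat \<delta> \<alpha>) J m n (tcls \<delta> \<alpha> m n f));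
             br = (\<lambda>m n. quot_mor (Tcat \<delta> \<alpha>) J (m + n) (n + m) (Tbraid \<delta> \<alpha> m n));
             E = Hom Q 2 2
         in \<pi> 2 2 tD = \<pi> 2 2 tK \<ominus>\<^bsub>E\<^esub> \<pi> 2 2 tH \<and>
            \<pi> 2 2 tK = (\<alpha> / 2) \<odot>\<^bsub>E\<^esub> (Idn Q 2 \<ominus>\<^bsub>E\<^esub> \<pi> 2 2 TS) \<and>
            lie_algebra_object Q br 1 (\<pi> 2 1 TM) \<and>
            selfdual_of_dimension Q 1 (\<pi> 0 2 TEta) (\<pi> 2 0 TEps) 3 \<and>
            \<delta> = 3"
proof -
  let ?Q = "quot_cat (Tcat \<delta> \<alpha>) J"
    and ?\<pi> = "\<lambda>m n f. quot_mor (Tcat \<delta> \<alpha>) J m n (tcls \<delta> \<alpha> m n f)"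
  have two: "(2::'k) \<noteq> 0"
  proof
    assume "(2::'k) = 0"
    then have "of_nat 2 = (0::'k)" by simp
    then have "CHAR('k) dvd 2" by (simp only: of_nat_eq_0_iff_char_dvd)
    then have "CHAR('k) = 1 \<or> CHAR('k) = 2" using two_is_prime_nat by (metis prime_nat_iff)
    then show False using assms(1) by simp
  qed
  interpret Q: term_presentation \<delta> \<alpha> ?Q ?\<pi> by (rule quot_Tcat_presentation[OF assms(4)])
  interpret Q: three_dimensional_presentation \<delta> \<alpha> ?Q ?\<pi>
    by unfold_locales (use two assms in simp_all)
  have br: "Q.br = (\<lambda>m n. quot_mor (Tcat \<delta> \<alpha>) J (m + n) (n + m) (Tbraid \<delta> \<alpha> m n))"
    by (intro ext) (simp add: Q.br_def Tbraid_def)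
  show ?thesis
    unfolding Let_def br[symmetric]
    using Q.crossed_H_relation Q.K_relation Q.lie_algebra Q.selfdual Q.delta_eq_3 by blast
qed

end
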